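(* Let $S$ be an integer valued random variable with mean $\mu$ and finite variance $\sigma^2>0$. Suppose $(S,S',G)$ is a Stein coupling, and let $D=S'-S$. Let $\mathcal{F}$ be a $\sigma$-field such that $\sigma(G,D)\subset\mathcal{F}$. Then $$ \begin{aligned} d_{\mathrm{TV}}\bigl(\mathcal{L}(S), N^d(\mu,\sigma^2)\bigr) \le{}& \frac{2}{\sigma^2}\sqrt{\mathrm{Var}\bigl(\mathbb{E}(GD\mid S)\bigr)}+\sqrt{\frac{\pi}{8}}\,\frac{\mathbb{E}|GD^2|}{\sigma^3}+\frac{\sqrt{\mathbb{E}\,G^2D^4}}{\sigma^3}\\ &+\frac{1}{2\sigma^2}\,\mathbb{E}\Bigl[\bigl(|GD^2|+|GD|\bigr)\,d_{\mathrm{TV}}\bigl(\mathcal{L}(S\mid\mathcal{F}),\mathcal{L}(S+1\mid\mathcal{F})\bigr)\Bigr]. \end{aligned} $$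
   Context: $\mathcal{L}(X)$ denotes the distribution of a random variable $X$, and $\mathcal{L}(X\mid\mathcal{F})$ its (regular) conditional distribution given a $\sigma$-field $\mathcal{F}$. The total variation distance is $d_{\mathrm{TV}}(\mathcal{L}(X),\mathcal{L}(Y))=\sup_{A\subset\mathbb{R}}|\mathbb{P}(X\in A)-\mathbb{P}(Y\in A)|$ (supremum over measurable $A$); thus $d_{\mathrm{TV}}(\mathcal{L}(S\mid\mathcal{F}),\mathcal{L}(S+1\mid\mathcal{F}))$ is an $\mathcal{F}$-measurable random variable. $\sigma(\cdot)$ denotes the $\sigma$-field generated by the listed random variables. Discretized normal distribution: $N^d(\mu,\sigma^2)$ is the distribution supported on $\mathbb{Z}$ with probability mass function at $z\in\mathbb{Z}$ equal to $\mathbb{P}(z-\tfrac12\le Z_{\mu,\sigma^2}<z+\tfrac12)$, where $Z_{\mu,\sigma^2}$ is a Gaussian variable with mean $\mu$ and variance $\sigma^2$. Stein coupling: for a random variable $S$ with mean $\mu$, a triple of square-integrable random variables $(S,S',G)$, defined on the same probability space, is a Stein coupling if $\mathbb{E}\{Gf(S')-Gf(S)\}=\mathbb{E}(S-\mu)f(S)$ for all functions $f$ such that these expectations exist. *)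

theory Defs
  imports "HOL-Probability.Probability"
begin

definition tv_dist :: "real measure \<Rightarrow> real measure \<Rightarrow> real" where
  "tv_dist P Q = (SUP A\<in>sets borel. \<bar>measure P A - measure Q A\<bar>)"

text \<open>
  The discretized normal distribution \<open>N\<^sup>d(\<mu>, \<sigma>\<^sup>2)\<close>, as a Borel measure on the reals. As for
  \<^const>\<open>normal_density\<close>, the second parameter is the standard deviation, not the variance.
\<close>

definition discretized_normal :: "real \<Rightarrow> real \<Rightarrow> real measure" where
  "discretized_normal \<mu> \<sigma> =
     distr (point_measure (UNIV :: int set)
              (\<lambda>z. emeasure (density lborel (normal_density \<mu> \<sigma>))
                     {real_of_int z - 1 / 2 ..< real_of_int z + 1 / 2}))
           borel real_of_int"

definition square_integrable :: "'a measure \<Rightarrow> ('a \<Rightarrow> real) \<Rightarrow> bool" where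
  "square_integrable M X \<longleftrightarrow> X \<in> borel_measurable M \<and> integrable M (\<lambda>\<omega>. (X \<omega>)\<^sup>2)"

definition stein_coupling ::
    "'a measure \<Rightarrow> ('a \<Rightarrow> real) \<Rightarrow> ('a \<Rightarrow> real) \<Rightarrow> ('a \<Rightarrow> real) \<Rightarrow> bool" where
  "stein_coupling M S S' G \<longleftrightarrow>
     square_integrable M S \<and> square_integrable M S' \<and> square_integrable M G \<and>
     (\<forall>f \<in> borel_measurable borel.
        integrable M (\<lambda>\<omega>. G \<omega> * f (S' \<omega>) - G \<omega> * f (S \<omega>)) \<longrightarrow>
        integrable M (\<lambda>\<omega>. (S \<omega> - (\<integral>x. S x \<partial>M)) * f (S \<omega>)) \<longrightarrow>
        (\<integral>\<omega>. G \<omega> * f (S' \<omega>) - G \<omega> * f (S \<omega>) \<partial>M)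
          = (\<integral>\<omega>. (S \<omega> - (\<integral>x. S x \<partial>M)) * f (S \<omega>) \<partial>M))"

text \<open>
  \<open>K\<close> is a version of the regular conditional distribution \<open>\<L>(X | \<F>)\<close>: an \<open>\<F>\<close>-measurable
  probability kernel whose value at each Borel set is a version of the conditional probability.
\<close>

definition regular_cond_distr ::
    "'a measure \<Rightarrow> 'a measure \<Rightarrow> ('a \<Rightarrow> real) \<Rightarrow> ('a \<Rightarrow> real measure) \<Rightarrow> bool" where
  "regular_cond_distr M F X K \<longleftrightarrow>
     K \<in> measurable F (prob_algebra borel) \<and>
     (\<forall>A\<in>sets borel. AE \<omega> in M.
        measure (K \<omega>) A = real_cond_exp M F (\<lambda>\<omega>'. indicator A (X \<omega>')) \<omega>)"

text \<open>
  The moments below may be infinite, so they take values in \<^typ>\<open>ennreal\<close>; the Bochner integral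
  of a non-integrable function is 0 by convention, which would make an upper bound wrong.
\<close>

definition ennreal_sqrt :: "ennreal \<Rightarrow> ennreal" where
  "ennreal_sqrt x = (if x = \<infinity> then \<infinity> else ennreal (sqrt (enn2real x)))"

text \<open>The variance of an integrable random variable, infinite if it is not square-integrable.\<close>

definition ennreal_variance :: "'a measure \<Rightarrow> ('a \<Rightarrow> real) \<Rightarrow> ennreal" where
  "ennreal_variance M X = (\<integral>\<^sup>+\<omega>. ennreal ((X \<omega> - (\<integral>x. X x \<partial>M))\<^sup>2) \<partial>M)"

lemma emeasure_distr_point_measure_int:
  assumes "A \<in> sets borel"
  shows "emeasure (distr (point_measure (UNIV :: int set) p) borel real_of_int) A
         = (\<integral>\<^sup>+z. p z * indicator A (real_of_int z) \<partial>count_space UNIV)"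
proof -
  have "emeasure (distr (point_measure (UNIV :: int set) p) borel real_of_int) A
      = emeasure (point_measure UNIV p) (real_of_int -` A)"
    using assms by (subst emeasure_distr) (auto simp: space_point_measure)
  also have "\<dots> = (\<integral>\<^sup>+z. p z * indicator (real_of_int -` A) z \<partial>count_space UNIV)"
    unfolding point_measure_def by (subst emeasure_density) auto
  finally show ?thesis by (simp add: indicator_def)
qed

lemma int_cells:
  shows "(\<Union>z. {real_of_int z - 1/2 ..< real_of_int z + 1/2}) = UNIV"
    and "disjoint_family (\<lambda>z. {real_of_int z - 1/2 ..< real_of_int z + 1/2})"
proof -
  have "x \<in> {real_of_int \<lfloor>x + 1/2\<rfloor> - 1/2 ..< real_of_int \<lfloor>x + 1/2\<rfloor> + 1/2}" for x :: real
    by simp linarith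
  then show "(\<Union>z. {real_of_int z - 1/2 ..< real_of_int z + 1/2}) = UNIV" by blast
  show "disjoint_family (\<lambda>z. {real_of_int z - 1/2 ..< real_of_int z + 1/2})"
    unfolding disjoint_family_on_def
  proof (intro ballI impI, rule ccontr)
    fix m n :: int
    assume "m \<noteq> n" and
      "{real_of_int m - 1/2 ..< real_of_int m + 1/2} \<inter> {real_of_int n - 1/2 ..< real_of_int n + 1/2} \<noteq> {}"
    then obtain x :: real where "real_of_int m - 1/2 \<le> x" "x < real_of_int m + 1/2"
        "real_of_int n - 1/2 \<le> x" "x < real_of_int n + 1/2" by auto
    then have "real_of_int m < real_of_int (n + 1)" "real_of_int n < real_of_int (m + 1)"
      by simp_all
    then have "m < n + 1" "n < m + 1" by linarith+
    then show False using \<open>m \<noteq> n\<close> by simp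
  qed
qed

lemma prob_space_discretized_normal:
  assumes "\<sigma> > 0"
  shows "prob_space (discretized_normal \<mu> \<sigma>)"
proof
  let ?N = "density lborel (normal_density \<mu> \<sigma>)"
  interpret N: prob_space ?N using assms by (rule prob_space_normal_density)
  have "emeasure (discretized_normal \<mu> \<sigma>) (space (discretized_normal \<mu> \<sigma>))
     = (\<integral>\<^sup>+z. emeasure ?N {real_of_int z - 1/2 ..< real_of_int z + 1/2} \<partial>count_space UNIV)"
    using emeasure_distr_point_measure_int[of UNIV] unfolding discretized_normal_def by simp
  also have "\<dots> = emeasure ?N (\<Union>z. {real_of_int z - 1/2 ..< real_of_int z + 1/2})"
    by (rule emeasure_UN_countable[symmetric]) (auto intro: int_cells(2))
  also have "\<dots> = 1" using N.emeasure_space_1 int_cells(1) by simp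
  finally show "emeasure (discretized_normal \<mu> \<sigma>) (space (discretized_normal \<mu> \<sigma>)) = 1" .
qed

text \<open>Integer valued random variables do have regular conditional distributions.\<close>

lemma regular_cond_distr_exists:
  fixes X :: "'a \<Rightarrow> real"
  assumes "prob_space M" "subalgebra M F"
    and X[measurable]: "X \<in> borel_measurable M" and int: "AE \<omega> in M. X \<omega> \<in> \<int>"
  shows "\<exists>K. regular_cond_distr M F X K"
proof -
  interpret prob_space M by fact
  interpret finite_measure_subalgebra M F
    using assms(2) by unfold_locales
  define p where "p z = nn_cond_exp M F (\<lambda>\<omega>. indicator {real_of_int z} (X \<omega>))" for z :: int
  have pF[measurable]: "p z \<in> borel_measurable F" for z
    unfolding p_def by (rule borel_measurable_nn_cond_exp)
  have pM[measurable]: "p z \<in> borel_measurable M" for z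
    using subalg pF by (rule measurable_from_subalg)
  define q where "q A \<omega> = (\<integral>\<^sup>+z. p z \<omega> * indicator A (real_of_int z) \<partial>count_space UNIV)" for A \<omega>
  have qF[measurable]: "q A \<in> borel_measurable F" for A
    unfolding q_def
  proof (rule sigma_finite_measure.borel_measurable_nn_integral[OF sigma_finite_measure_count_space])
    show "(\<lambda>(\<omega>, z). p z \<omega> * indicator A (real_of_int z)) \<in> borel_measurable (F \<Otimes>\<^sub>M count_space UNIV)"
      by (subst measurable_pair_swap_iff, rule measurable_pair_measure_countable1) auto
  qed
  have qM[measurable]: "q A \<in> borel_measurable M" for A
    using subalg qF by (rule measurable_from_subalg)
  have q: "AE \<omega> in M. q A \<omega> = nn_cond_exp M F (\<lambda>\<omega>. indicator A (X \<omega>)) \<omega>"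
    if A[measurable]: "A \<in> sets borel" for A
  proof (rule nn_cond_exp_charact)
    fix B assume B[measurable]: "B \<in> sets F"
    then have [measurable]: "B \<in> sets M" using subalg by (auto simp: subalgebra_def)
    have "(\<integral>\<^sup>+\<omega>\<in>B. q A \<omega> \<partial>M)
        = (\<integral>\<^sup>+\<omega>. (\<integral>\<^sup>+z. indicator A (real_of_int z) * (indicator B \<omega> * p z \<omega>) \<partial>count_space UNIV) \<partial>M)"
      unfolding q_def by (subst nn_integral_multc[symmetric]) (auto intro!: nn_integral_cong simp: ac_simps)
    also have "\<dots> = (\<integral>\<^sup>+z. (\<integral>\<^sup>+\<omega>. indicator A (real_of_int z) * (indicator B \<omega> * p z \<omega>) \<partial>M) \<partial>count_space UNIV)"
      by (rule nn_integral_count_space_nn_integral) auto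
    also have "\<dots> = (\<integral>\<^sup>+z. indicator A (real_of_int z) *
                 (\<integral>\<^sup>+\<omega>. indicator B \<omega> * indicator {real_of_int z} (X \<omega>) \<partial>M) \<partial>count_space UNIV)"
      unfolding p_def
      by (intro nn_integral_cong) (subst nn_integral_cmult, auto simp: nn_cond_exp_intg)
    also have "\<dots> = (\<integral>\<^sup>+\<omega>. (\<integral>\<^sup>+z. indicator A (real_of_int z) *
                 (indicator B \<omega> * indicator {real_of_int z} (X \<omega>)) \<partial>count_space UNIV) \<partial>M)"
      by (subst nn_integral_count_space_nn_integral)
         (auto intro!: nn_integral_cong nn_integral_cmult[symmetric])
    also have "\<dots> = (\<integral>\<^sup>+\<omega>\<in>B. indicator A (X \<omega>) \<partial>M)"
    proof (rule nn_integral_cong_AE, use int in eventually_elim)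
      fix \<omega> assume "X \<omega> \<in> \<int>"
      then obtain k where k: "X \<omega> = real_of_int k" by (auto elim: Ints_cases)
      have "(\<integral>\<^sup>+z. indicator A (real_of_int z) * (indicator B \<omega> * indicator {real_of_int z} (X \<omega>)) \<partial>count_space UNIV)
          = (\<integral>\<^sup>+z. indicator A (X \<omega>) * indicator B \<omega> * indicator {k} z \<partial>count_space UNIV)"
        by (intro nn_integral_cong) (auto simp: k indicator_def)
      also have "\<dots> = indicator A (X \<omega>) * indicator B \<omega>"
        by (subst nn_integral_cmult_indicator) auto
      finally show "(\<integral>\<^sup>+z. indicator A (real_of_int z) * (indicator B \<omega> * indicator {real_of_int z} (X \<omega>)) \<partial>count_space UNIV)
          = indicator A (X \<omega>) * indicator B \<omega>" .
    qed
    finally show "(\<integral>\<^sup>+\<omega>\<in>B. indicator A (X \<omega>) \<partial>M) = (\<integral>\<^sup>+\<omega>\<in>B. q A \<omega> \<partial>M)" by simp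
  qed auto
  have "AE \<omega> in M. nn_cond_exp M F (\<lambda>_. 1) \<omega> = 1"
    by (rule AE_mp[OF nn_cond_exp_F_meas[of "\<lambda>_. 1"]]) auto
  with q[of UNIV] have q1: "AE \<omega> in M. q UNIV \<omega> = 1" by auto
  define K where "K \<omega> = (if q UNIV \<omega> = 1
      then distr (point_measure UNIV (\<lambda>z. p z \<omega>)) borel real_of_int else return borel 0)" for \<omega>
  have emK: "emeasure (K \<omega>) A = (if q UNIV \<omega> = 1 then q A \<omega> else indicator A 0)"
    if "A \<in> sets borel" for A \<omega>
    using that by (simp add: K_def q_def emeasure_distr_point_measure_int)
  have setsK: "sets (K \<omega>) = sets borel" for \<omega> by (simp add: K_def)
  have spaceK: "space (K \<omega>) = UNIV" for \<omega> by (simp add: K_def)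
  have probK: "prob_space (K \<omega>)" for \<omega>
    by (rule prob_spaceI) (simp add: spaceK emK)
  have "K \<in> measurable F (prob_algebra borel)"
  proof (rule measurable_prob_algebraI)
    show "K \<in> measurable F (subprob_algebra borel)"
      by (rule measurable_subprob_algebra)
         (auto simp: setsK emK probK prob_space_imp_subprob_space)
  qed (rule probK)
  moreover have "AE \<omega> in M. measure (K \<omega>) A = real_cond_exp M F (\<lambda>\<omega>'. indicator A (X \<omega>')) \<omega>"
    if A[measurable]: "A \<in> sets borel" for A
  proof -
    have *: "(\<lambda>\<omega>. ennreal (indicator A (X \<omega>))) = (\<lambda>\<omega>. indicator A (X \<omega>))"
      "(\<lambda>\<omega>. ennreal (- indicator A (X \<omega>))) = (\<lambda>\<omega>. 0)"
      by (auto simp: fun_eq_iff ennreal_neg split: split_indicator)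
    have "AE \<omega> in M. nn_cond_exp M F (\<lambda>_. 0) \<omega> = 0"
      by (rule AE_mp[OF nn_cond_exp_F_meas[of "\<lambda>_. 0"]]) auto
    with q1 q[OF A] show ?thesis
      by eventually_elim (simp add: measure_def emK real_cond_exp_def *)
  qed
  ultimately show ?thesis unfolding regular_cond_distr_def by blast
qed

end

theory Submission
  imports Defs "HOL-Real_Asymp.Real_Asymp"
begin

text \<open>
  The proof is Stein's method for the normal distribution with a test function adapted to the
  lattice. For a Borel set \<open>A\<close> let \<open>h = cell_round A\<close> be the indicator of \<open>A\<close> at the nearest integer.
  It equals the indicator of \<open>A\<close> on the integers, and its mean \<open>p\<close> under \<open>N(\<mu>, \<sigma>\<^sup>2)\<close> is the mass of \<open>A\<close>
  under \<open>N\<^sup>d(\<mu>, \<sigma>\<^sup>2)\<close>, so \<open>P(S \<in> A) - p = E(h(S) - p)\<close>. The Stein equation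
  \<open>\<sigma>\<^sup>2 f'(x) - (x - \<mu>) f(x) = h(x) - p\<close> has a bounded solution with bounded derivative
  (lemma \<open>stein_solution\<close>), and the coupling turns \<open>E((S - \<mu>) f(S))\<close> into \<open>E(G (f(S + D) - f(S)))\<close>.

  Expanding \<open>f\<close> to first order around \<open>S\<close> leaves three errors. The linear part contributes
  \<open>E((\<sigma>\<^sup>2 - G D) f'(S))\<close>; since \<open>E(G D) = \<sigma>\<^sup>2\<close>, it is controlled by the variance of \<open>E(G D | S)\<close>
  (lemma \<open>variance_term_bound\<close>). The increment \<open>f'(S + t) - f'(S)\<close> splits by the Stein equation into the
  increment of \<open>(x - \<mu>) f(x)\<close>, which is of order \<open>\<bar>t\<bar>\<close> and yields the two moment terms (lemma
  \<open>stein_solution_taylor\<close> and the Cauchy-Schwarz inequality), and the increment \<open>h(S + t) - h(S)\<close>, which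
  need not be small for a single outcome. But \<open>S\<close> is an integer, so the latter compares two integer
  translates of \<open>S\<close>, and in the mean given \<open>\<F>\<close> it is at most \<open>\<bar>\<lfloor>t + 1/2\<rfloor>\<bar>\<close> times the distance between
  \<open>\<L>(S | \<F>)\<close> and \<open>\<L>(S + 1 | \<F>)\<close>; integrating this over \<open>t\<close> between \<open>0\<close> and \<open>D\<close> gives the
  last term (lemma \<open>smoothing_term_bound\<close>).

  The errors are estimated as nonnegative extended integrals, so infinite moments are covered
  by the same estimates.
\<close>

section \<open>Integral inequalities\<close>

lemma ennreal_abs_integral_le: "ennreal \<bar>\<integral>x. f x \<partial>M\<bar> \<le> (\<integral>\<^sup>+x. ennreal \<bar>f x\<bar> \<partial>M)" for f :: "'a \<Rightarrow> real"
proof (cases "integrable M f")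
  case True then show ?thesis using integral_norm_bound_ennreal[OF True] by simp
qed (simp add: not_integrable_integral_eq)

lemma le_ennreal_sqrt:
  assumes "x\<^sup>2 \<le> y" shows "x \<le> ennreal_sqrt y"
proof (cases y)
  case (real r)
  then have "x \<noteq> top" using assms by (auto simp: power2_eq_square top_unique)
  then obtain z where z: "x = ennreal z" "z \<ge> 0" by (cases x) auto
  then have "z\<^sup>2 \<le> r" using assms real by (simp add: ennreal_power)
  then have "z \<le> sqrt r" by (rule real_le_rsqrt)
  then show ?thesis using real z by (auto simp: ennreal_sqrt_def intro!: ennreal_leI)
qed (simp add: ennreal_sqrt_def)

lemma integrable_mult_of_squares:
  fixes X Y :: "'a \<Rightarrow> real"
  assumes [measurable]: "X \<in> borel_measurable M" "Y \<in> borel_measurable M"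
    and "integrable M (\<lambda>\<omega>. (X \<omega>)\<^sup>2)" "integrable M (\<lambda>\<omega>. (Y \<omega>)\<^sup>2)"
  shows "integrable M (\<lambda>\<omega>. X \<omega> * Y \<omega>)"
proof (rule Bochner_Integration.integrable_bound)
  show "integrable M (\<lambda>\<omega>. (X \<omega>)\<^sup>2 + (Y \<omega>)\<^sup>2)" using assms by auto
  have "\<bar>x * y\<bar> \<le> x\<^sup>2 + y\<^sup>2" for x y :: real
  proof -
    have "2 * (\<bar>x\<bar> * \<bar>y\<bar>) \<le> x\<^sup>2 + y\<^sup>2" using sum_squares_bound[of "\<bar>x\<bar>" "\<bar>y\<bar>"] by simp
    moreover have "0 \<le> \<bar>x\<bar> * \<bar>y\<bar>" by simp
    ultimately show ?thesis unfolding abs_mult by linarith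
  qed
  then show "AE \<omega> in M. norm (X \<omega> * Y \<omega>) \<le> norm ((X \<omega>)\<^sup>2 + (Y \<omega>)\<^sup>2)" by simp
qed simp

lemma nn_integral_mult_le_ennreal_sqrt:
  fixes X Y :: "'a \<Rightarrow> real"
  assumes [measurable]: "X \<in> borel_measurable M" "Y \<in> borel_measurable M"
    and c: "c > 0" and Y: "(\<integral>\<^sup>+\<omega>. ennreal ((Y \<omega>)\<^sup>2) \<partial>M) = ennreal (c\<^sup>2)"
  shows "(\<integral>\<^sup>+\<omega>. ennreal \<bar>X \<omega> * Y \<omega>\<bar> \<partial>M) \<le> ennreal c * ennreal_sqrt (\<integral>\<^sup>+\<omega>. ennreal ((X \<omega>)\<^sup>2) \<partial>M)"
proof -
  define I where "I = (\<integral>\<^sup>+\<omega>. ennreal \<bar>X \<omega> * Y \<omega>\<bar> \<partial>M)"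
  define Q where "Q = (\<integral>\<^sup>+\<omega>. ennreal ((X \<omega>)\<^sup>2) \<partial>M)"
  have cancel: "ennreal (1 / c) * ennreal c = 1" using c by (subst ennreal_mult[symmetric]) auto
  have "I\<^sup>2 \<le> Q * ennreal (c\<^sup>2)"
    using Cauchy_Schwarz_nn_integral[of "\<lambda>\<omega>. ennreal \<bar>X \<omega>\<bar>" M "\<lambda>\<omega>. ennreal \<bar>Y \<omega>\<bar>"] Y
    by (simp add: I_def Q_def abs_mult ennreal_mult ennreal_power)
  then have "(ennreal (1 / c))\<^sup>2 * I\<^sup>2 \<le> (ennreal (1 / c))\<^sup>2 * (Q * (ennreal c)\<^sup>2)"
    using c by (intro mult_left_mono) (auto simp: ennreal_power)
  also have "\<dots> = Q * (ennreal (1 / c) * ennreal c)\<^sup>2" by (simp only: power_mult_distrib mult_ac)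
  finally have "(ennreal (1 / c) * I)\<^sup>2 \<le> Q" by (simp add: power_mult_distrib cancel)
  then have "ennreal (1 / c) * I \<le> ennreal_sqrt Q" by (rule le_ennreal_sqrt)
  then have "ennreal c * (ennreal (1 / c) * I) \<le> ennreal c * ennreal_sqrt Q" by (rule mult_left_mono) simp
  then show ?thesis using cancel by (simp add: mult.assoc[symmetric] mult.commute I_def Q_def)
qed

section \<open>Gaussian tails and the Stein equation\<close>

lemma DERIV_normal_density:
  "(normal_density \<mu> \<sigma> has_real_derivative - ((x - \<mu>) / \<sigma>\<^sup>2 * normal_density \<mu> \<sigma> x)) (at x)"
proof -
  have "((\<lambda>u. - (u - \<mu>)\<^sup>2) has_real_derivative - (2 * (x - \<mu>))) (at x)"
    by (auto intro!: derivative_eq_intros)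
  then have D: "((\<lambda>u. - (u - \<mu>)\<^sup>2 / (2 * \<sigma>\<^sup>2)) has_real_derivative - (2 * (x - \<mu>)) / (2 * \<sigma>\<^sup>2)) (at x)"
    by (rule DERIV_cdivide)
  have "- (2 * a) / (2 * q) = - (a / q)" for a q :: real by simp
  from DERIV_cmult[OF DERIV_chain2[OF DERIV_exp D[unfolded this]], of "1 / sqrt (2 * pi * \<sigma>\<^sup>2)"]
  show ?thesis by (simp add: normal_density_def[abs_def] mult_ac)
qed

text \<open>
  Substituting \<open>u = x + \<surd>2 \<sigma> v\<close>, the cross term in \<open>(u - \<mu>)\<^sup>2\<close> is nonnegative for \<open>x \<ge> \<mu>\<close>, so the
  density splits off the factor \<open>exp (- v\<^sup>2)\<close>, which has half-line integral \<open>\<surd>\<pi> / 2\<close>.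
\<close>

lemma normal_density_upper_tail:
  assumes s: "\<sigma> > 0" and x: "\<mu> \<le> x"
  shows "(\<integral>u. indicator {x..} u * normal_density \<mu> \<sigma> u \<partial>lborel) \<le> \<sigma> * sqrt (pi / 2) * normal_density \<mu> \<sigma> x"
proof -
  let ?n = "normal_density \<mu> \<sigma>" and ?c = "sqrt 2 * \<sigma>"
  have c: "?c > 0" using s by simp
  have g: "integrable lborel (\<lambda>v. indicator {0..} v * exp (- v\<^sup>2) :: real)"
    "(\<integral>v. indicator {0..} v * exp (- v\<^sup>2) \<partial>lborel) = sqrt pi / 2"
    using gaussian_moment_0 by (auto simp: has_bochner_integral_iff)
  have le: "?n (x + ?c * v) \<le> ?n x * exp (- v\<^sup>2)" if "v \<ge> 0" for v
  proof -
    have "(x + ?c * v - \<mu>)\<^sup>2 = (x - \<mu>)\<^sup>2 + 2 * (x - \<mu>) * (?c * v) + 2 * \<sigma>\<^sup>2 * v\<^sup>2"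
      by (simp add: power2_eq_square algebra_simps)
    also have "\<dots> \<ge> (x - \<mu>)\<^sup>2 + 2 * \<sigma>\<^sup>2 * v\<^sup>2"
      using x s that by simp
    finally have "(x - \<mu>)\<^sup>2 + 2 * \<sigma>\<^sup>2 * v\<^sup>2 \<le> (x + ?c * v - \<mu>)\<^sup>2" .
    then have "- (x + ?c * v - \<mu>)\<^sup>2 / (2 * \<sigma>\<^sup>2) \<le> (- ((x - \<mu>)\<^sup>2 + 2 * \<sigma>\<^sup>2 * v\<^sup>2)) / (2 * \<sigma>\<^sup>2)"
      by (intro divide_right_mono) auto
    also have "\<dots> = - (x - \<mu>)\<^sup>2 / (2 * \<sigma>\<^sup>2) + - v\<^sup>2"
      using s by (simp add: field_simps)
    finally have "exp (- (x + ?c * v - \<mu>)\<^sup>2 / (2 * \<sigma>\<^sup>2)) \<le> exp (- (x - \<mu>)\<^sup>2 / (2 * \<sigma>\<^sup>2)) * exp (- v\<^sup>2)"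
      by (simp only: exp_add[symmetric] exp_le_cancel_iff)
    then show ?thesis
      unfolding normal_density_def using s by (simp add: mult.assoc divide_right_mono)
  qed
  have shift: "(\<integral>u. indicator {x..} u * ?n u \<partial>lborel) = ?c * (\<integral>v. indicator {x..} (x + ?c * v) * ?n (x + ?c * v) \<partial>lborel)"
    using lborel_integral_real_affine[of ?c "\<lambda>u. indicator {x..} u * ?n u" x] c s by simp
  have "(\<integral>v. indicator {x..} (x + ?c * v) * ?n (x + ?c * v) \<partial>lborel)
      \<le> (\<integral>v. ?n x * (indicator {0..} v * exp (- v\<^sup>2)) \<partial>lborel)"
  proof (rule integral_mono')
    show "integrable lborel (\<lambda>v. ?n x * (indicator {0..} v * exp (- v\<^sup>2)))"
      using g(1) by (rule integrable_mult_right)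
    show "indicator {x..} (x + ?c * v) * ?n (x + ?c * v) \<le> ?n x * (indicator {0..} v * exp (- v\<^sup>2))" for v
    proof (cases "v \<ge> 0")
      case True then show ?thesis using le[of v] c by (simp add: indicator_def)
    next
      case False then show ?thesis using mult_pos_neg[OF c, of v] by (simp add: indicator_def)
    qed
  qed (simp add: indicator_def)
  also have "\<dots> = ?n x * (sqrt pi / 2)" using g(2) by simp
  finally have "?c * (\<integral>v. indicator {x..} (x + ?c * v) * ?n (x + ?c * v) \<partial>lborel) \<le> ?c * (?n x * (sqrt pi / 2))"
    by (rule mult_left_mono) (use c in simp)
  also have "?c * (?n x * (sqrt pi / 2)) = \<sigma> * sqrt (pi / 2) * ?n x"
    by (simp add: real_sqrt_divide field_simps)
  finally show ?thesis unfolding shift .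
qed

text \<open>
  On the domain of integration \<open>x - \<mu> \<le> u - \<mu>\<close>, and \<open>(u - \<mu>) n(u)\<close> is the derivative
  of \<open>- \<sigma>\<^sup>2 n(u)\<close>.
\<close>

lemma normal_density_mills:
  assumes s: "\<sigma> > 0" and x: "\<mu> \<le> x"
  shows "(x - \<mu>) * (\<integral>u. indicator {x..} u * normal_density \<mu> \<sigma> u \<partial>lborel) \<le> \<sigma>\<^sup>2 * normal_density \<mu> \<sigma> x"
proof -
  let ?n = "normal_density \<mu> \<sigma>"
  have D: "((\<lambda>u. - \<sigma>\<^sup>2 * ?n u) has_real_derivative (u - \<mu>) * ?n u) (at u)" for u
    using DERIV_cmult[OF DERIV_normal_density[of \<mu> \<sigma> u], of "- \<sigma>\<^sup>2"] s by simp
  have lim: "((\<lambda>u. - \<sigma>\<^sup>2 * ?n u) \<longlongrightarrow> 0) at_top"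
    unfolding normal_density_def using s by real_asymp
  have nonneg: "AE u in lborel. 0 \<le> indicator {x..} u * ((u - \<mu>) * ?n u)"
    using x by (auto simp: indicator_def)
  have "(\<integral>\<^sup>+u. ennreal (indicator {x..} u * ((u - \<mu>) * ?n u)) \<partial>lborel)
      = (\<integral>\<^sup>+u. ennreal ((u - \<mu>) * ?n u) * indicator {x..} u \<partial>lborel)"
    by (intro nn_integral_cong) (auto simp: indicator_def)
  also have "\<dots> = ennreal (0 - (- \<sigma>\<^sup>2 * ?n x))"
    using x by (intro nn_integral_FTC_atLeast D lim) auto
  finally have nn: "(\<integral>\<^sup>+u. ennreal (indicator {x..} u * ((u - \<mu>) * ?n u)) \<partial>lborel) = ennreal (\<sigma>\<^sup>2 * ?n x)"
    by simp
  have int: "integrable lborel (\<lambda>u. indicator {x..} u * ((u - \<mu>) * ?n u))"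
    using nonneg nn by (intro integrableI_nonneg) auto
  have "(\<integral>u. (x - \<mu>) * (indicator {x..} u * ?n u) \<partial>lborel) \<le> (\<integral>u. indicator {x..} u * ((u - \<mu>) * ?n u) \<partial>lborel)"
    using x int by (intro integral_mono') (auto simp: indicator_def intro!: mult_right_mono)
  also have "\<dots> = \<sigma>\<^sup>2 * ?n x"
    using nonneg nn by (subst integral_eq_nn_integral) auto
  finally show ?thesis by simp
qed

text \<open>
  Both tails at once, weighted by a function bounded by one; reflection in \<open>\<mu>\<close> carries the lower
  tail to the upper one.
\<close>

lemma normal_density_tails:
  assumes s: "\<sigma> > 0" and g[measurable]: "g \<in> borel_measurable borel" and g1: "\<And>u. \<bar>g u\<bar> \<le> 1"
    and T: "\<mu> \<le> x \<and> T = {x..} \<or> x \<le> \<mu> \<and> T = {..x}"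
  shows "\<bar>\<integral>u. indicator T u * (g u * normal_density \<mu> \<sigma> u) \<partial>lborel\<bar> \<le> \<sigma> * sqrt (pi / 2) * normal_density \<mu> \<sigma> x"
    and "\<bar>x - \<mu>\<bar> * \<bar>\<integral>u. indicator T u * (g u * normal_density \<mu> \<sigma> u) \<partial>lborel\<bar> \<le> \<sigma>\<^sup>2 * normal_density \<mu> \<sigma> x"
proof -
  let ?n = "normal_density \<mu> \<sigma>"
  define y where "y = \<mu> + \<bar>x - \<mu>\<bar>"
  have [measurable]: "T \<in> sets borel" using T by auto
  have eq: "(\<integral>u. indicator T u * ?n u \<partial>lborel) = (\<integral>u. indicator {y..} u * ?n u \<partial>lborel)"
    using T
  proof
    assume "\<mu> \<le> x \<and> T = {x..}"
    then show ?thesis by (simp add: y_def)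
  next
    assume lower: "x \<le> \<mu> \<and> T = {..x}"
    have "(\<integral>u. indicator T u * ?n u \<partial>lborel) = (\<integral>u. indicator T (2 * \<mu> + (-1) * u) * ?n (2 * \<mu> + (-1) * u) \<partial>lborel)"
      using lborel_integral_real_affine[of "-1" "\<lambda>u. indicator T u * ?n u" "2 * \<mu>"] by simp
    also have "\<dots> = (\<integral>u. indicator {y..} u * ?n u \<partial>lborel)"
      using lower by (intro Bochner_Integration.integral_cong) (auto simp: indicator_def y_def normal_density_def power2_commute)
    finally show ?thesis .
  qed
  have ny: "?n y = ?n x" by (auto simp: y_def normal_density_def)
  have "\<bar>\<integral>u. indicator T u * (g u * ?n u) \<partial>lborel\<bar> \<le> (\<integral>u. \<bar>indicator T u * (g u * ?n u)\<bar> \<partial>lborel)"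
    by (rule integral_abs_bound)
  also have "\<dots> \<le> (\<integral>u. indicator T u * ?n u \<partial>lborel)"
  proof (rule integral_mono')
    show "integrable lborel (\<lambda>u. indicator T u * ?n u)"
      using integrable_real_mult_indicator[of T lborel ?n] s by (simp add: mult.commute)
    show "\<bar>indicator T u * (g u * ?n u)\<bar> \<le> indicator T u * ?n u" for u
      using g1[of u] s by (auto simp: indicator_def abs_mult mult_left_le_one_le)
  qed auto
  finally have le: "\<bar>\<integral>u. indicator T u * (g u * ?n u) \<partial>lborel\<bar> \<le> (\<integral>u. indicator {y..} u * ?n u \<partial>lborel)" by (simp add: eq)
  have y: "\<mu> \<le> y" by (simp add: y_def)
  show "\<bar>\<integral>u. indicator T u * (g u * ?n u) \<partial>lborel\<bar> \<le> \<sigma> * sqrt (pi / 2) * ?n x"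
    using le normal_density_upper_tail[OF s y] by (simp add: ny)
  have "\<bar>x - \<mu>\<bar> * \<bar>\<integral>u. indicator T u * (g u * ?n u) \<partial>lborel\<bar> \<le> (y - \<mu>) * (\<integral>u. indicator {y..} u * ?n u \<partial>lborel)"
    using le by (auto simp: y_def intro!: mult_left_mono)
  also have "\<dots> \<le> \<sigma>\<^sup>2 * ?n x" using normal_density_mills[OF s y] by (simp add: ny)
  finally show "\<bar>x - \<mu>\<bar> * \<bar>\<integral>u. indicator T u * (g u * ?n u) \<partial>lborel\<bar> \<le> \<sigma>\<^sup>2 * ?n x" .
qed

text \<open>
  The classical solution is \<open>f(x) = (\<sigma>\<^sup>2 n(x))\<^sup>-\<^sup>1 \<integral>\<^bsub>u \<le> x\<^esub> (h(u) - p) n(u) du\<close>, with \<open>n\<close> the normal density.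
  Because \<open>h - p\<close> has normal mean zero, the integral may be taken over either tail at \<open>x\<close>; the tail
  pointing away from \<open>\<mu>\<close> gives \<open>\<bar>f(x)\<bar> \<le> \<surd>(\<pi>/2) / \<sigma>\<close> and \<open>\<bar>(x - \<mu>) f(x)\<bar> \<le> 1\<close>. The function \<open>f'\<close> is
  defined from \<open>f\<close> by the Stein equation at every point, hence is bounded by \<open>(1 + 1) / \<sigma>\<^sup>2\<close>, as
  \<open>\<bar>h - p\<bar> \<le> 1\<close>. It is the derivative of \<open>f\<close> wherever \<open>h\<close> is continuous, and finitely many exceptions
  on a bounded interval do not prevent \<open>f\<close> from being recovered by integration.
\<close>

lemma stein_solution:
  fixes \<mu> \<sigma> p :: real and h :: "real \<Rightarrow> real"
  assumes s: "\<sigma> > 0" and h[measurable]: "h \<in> borel_measurable borel"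
    and h01: "\<And>u. 0 \<le> h u \<and> h u \<le> 1"
    and p: "p = (\<integral>u. h u * normal_density \<mu> \<sigma> u \<partial>lborel)"
    and cont: "\<And>a b. \<exists>X. finite X \<and> (\<forall>x\<in>{a<..<b} - X. isCont h x)"
  obtains f f' where "f \<in> borel_measurable borel" "f' \<in> borel_measurable borel"
    "\<And>x. \<sigma>\<^sup>2 * f' x = (x - \<mu>) * f x + h x - p"
    "\<And>x. \<bar>f x\<bar> \<le> sqrt (pi / 2) / \<sigma>" "\<And>x. \<bar>f' x\<bar> \<le> 2 / \<sigma>\<^sup>2"
    "\<And>a b. a \<le> b \<Longrightarrow> (f' has_integral (f b - f a)) {a..b}"
proof -
  let ?n = "normal_density \<mu> \<sigma>"
  define g where "g u = h u - p" for u
  define I where "I x = (\<integral>u. indicator {..x} u * (g u * ?n u) \<partial>lborel)" for x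
  define f where "f x = I x / (\<sigma>\<^sup>2 * ?n x)" for x
  define f' where "f' x = ((x - \<mu>) * f x + g x) / \<sigma>\<^sup>2" for x
  have npos: "?n x > 0" for x using s by (rule normal_density_pos)
  have ni: "integrable lborel ?n" using s by (rule integrable_normal_density)
  have hn: "integrable lborel (\<lambda>u. h u * ?n u)"
    by (rule Bochner_Integration.integrable_bound[OF ni])
       (use h01 npos in \<open>auto simp: abs_mult less_imp_le mult_left_le_one_le\<close>)
  have p01: "0 \<le> p" "p \<le> 1"
  proof -
    show "0 \<le> p" unfolding p using h01 npos by (intro integral_nonneg_AE) (auto intro: less_imp_le)
    have "p \<le> (\<integral>u. ?n u \<partial>lborel)" unfolding p using h01 npos
      by (intro integral_mono[OF hn ni]) (auto simp: less_imp_le mult_left_le_one_le)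
    then show "p \<le> 1" using s by simp
  qed
  have g1: "\<bar>g u\<bar> \<le> 1" for u using h01[of u] p01 by (auto simp: g_def)
  have g[measurable]: "g \<in> borel_measurable borel" unfolding g_def by measurable
  have gn: "integrable lborel (\<lambda>u. g u * ?n u)"
    by (rule Bochner_Integration.integrable_bound[OF ni])
       (use g1 npos in \<open>auto simp: abs_mult less_imp_le mult_left_le_one_le\<close>)
  have gnT: "integrable lborel (\<lambda>u. indicator T u * (g u * ?n u))" if "T \<in> sets borel" for T
    using integrable_real_mult_indicator[OF _ gn, of T] that by (simp add: mult.commute)
  have "(\<integral>u. g u * ?n u \<partial>lborel) = (\<integral>u. h u * ?n u - p * ?n u \<partial>lborel)"
    by (simp add: g_def left_diff_distrib)
  also have "\<dots> = 0" using s by (subst Bochner_Integration.integral_diff[OF hn]) (auto simp: p)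
  finally have g0: "(\<integral>u. g u * ?n u \<partial>lborel) = 0" .
  have I_upper: "I x = - (\<integral>u. indicator {x..} u * (g u * ?n u) \<partial>lborel)" for x
  proof -
    have "I x + (\<integral>u. indicator {x..} u * (g u * ?n u) \<partial>lborel)
        = (\<integral>u. indicator {..x} u * (g u * ?n u) + indicator {x..} u * (g u * ?n u) \<partial>lborel)"
      unfolding I_def by (rule Bochner_Integration.integral_add[symmetric]) (auto intro: gnT)
    also have "\<dots> = (\<integral>u. g u * ?n u \<partial>lborel)"
      by (rule integral_cong_AE, measurable) (use AE_lborel_singleton[of x] in \<open>auto elim!: eventually_mono simp: indicator_def\<close>)
    finally show ?thesis using g0 by simp
  qed
  have I_bounds: "\<bar>I x\<bar> \<le> \<sigma> * sqrt (pi / 2) * ?n x" "\<bar>x - \<mu>\<bar> * \<bar>I x\<bar> \<le> \<sigma>\<^sup>2 * ?n x" for x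
  proof -
    consider "\<mu> \<le> x" | "x \<le> \<mu>" by linarith
    then have "\<bar>I x\<bar> \<le> \<sigma> * sqrt (pi / 2) * ?n x \<and> \<bar>x - \<mu>\<bar> * \<bar>I x\<bar> \<le> \<sigma>\<^sup>2 * ?n x"
    proof cases
      case 1 then show ?thesis unfolding I_upper
        using normal_density_tails[OF s g g1, where \<mu>=\<mu> and x=x and T="{x..}"] by simp
    next
      case 2 then show ?thesis unfolding I_def
        using normal_density_tails[OF s g g1, where \<mu>=\<mu> and x=x and T="{..x}"] by simp
    qed
    then show "\<bar>I x\<bar> \<le> \<sigma> * sqrt (pi / 2) * ?n x" "\<bar>x - \<mu>\<bar> * \<bar>I x\<bar> \<le> \<sigma>\<^sup>2 * ?n x" by auto
  qed
  have fb: "\<bar>f x\<bar> \<le> sqrt (pi / 2) / \<sigma>" for x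
    using I_bounds(1)[of x] npos[of x] s
    by (simp add: f_def abs_mult divide_simps) (simp add: power2_eq_square algebra_simps)
  have xfb: "\<bar>(x - \<mu>) * f x\<bar> \<le> 1" for x
    using I_bounds(2)[of x] npos[of x] s by (simp add: f_def abs_mult divide_simps)
  have f'b: "\<bar>f' x\<bar> \<le> 2 / \<sigma>\<^sup>2" for x
  proof -
    have "\<bar>(x - \<mu>) * f x + g x\<bar> \<le> 2" using xfb[of x] g1[of x] by linarith
    then show ?thesis using s by (simp add: f'_def divide_right_mono)
  qed
  have I_step: "I x = I a + integral {a..x} (\<lambda>u. g u * ?n u)" if "a \<le> x" for a x
  proof -
    have "integral {a..x} (\<lambda>u. g u * ?n u) = (\<integral>u. indicator {a..x} u * (g u * ?n u) \<partial>lborel)"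
      using set_borel_integral_eq_integral(2)[of "{a..x}" "\<lambda>u. g u * ?n u"] gnT[of "{a..x}"]
      by (simp add: set_integrable_def set_lebesgue_integral_def)
    then have "I a + integral {a..x} (\<lambda>u. g u * ?n u)
        = (\<integral>u. indicator {..a} u * (g u * ?n u) + indicator {a..x} u * (g u * ?n u) \<partial>lborel)"
      unfolding I_def by (subst Bochner_Integration.integral_add) (auto intro: gnT)
    also have "\<dots> = I x" unfolding I_def
      by (rule integral_cong_AE, measurable) (use that AE_lborel_singleton[of a] in \<open>auto elim!: eventually_mono simp: indicator_def\<close>)
    finally show ?thesis by simp
  qed
  have gni: "(\<lambda>u. g u * ?n u) integrable_on {a..x}" for a x
    using set_borel_integral_eq_integral(1)[of "{a..x}" "\<lambda>u. g u * ?n u"] gnT[of "{a..x}"]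
    by (simp add: set_integrable_def)
  have I_cont: "continuous_on {a..b} I" if "a \<le> b" for a b
  proof -
    have "continuous_on {a..b} (\<lambda>x. I a + integral {a..x} (\<lambda>u. g u * ?n u))"
      by (intro continuous_intros indefinite_integral_continuous_1 gni)
    then show ?thesis by (rule continuous_on_eq) (simp add: I_step[symmetric])
  qed
  have n_cont: "isCont ?n x" for x using s unfolding normal_density_def by (intro continuous_intros) auto
  have n_cont_on: "continuous_on X ?n" for X by (intro continuous_at_imp_continuous_on ballI n_cont)
  have f_cont: "continuous_on {a..b} f" if "a \<le> b" for a b
    unfolding f_def using npos s by (intro continuous_intros I_cont that n_cont_on) (auto simp: less_imp_neq[symmetric])
  have "f \<in> borel_measurable borel"
  proof (rule borel_measurable_continuous_onI, rule continuous_at_imp_continuous_on, rule ballI)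
    fix x :: real
    show "isCont f x"
      using f_cont[of "x - 1" "x + 1"] by (rule continuous_on_interior) auto
  qed
  note [measurable] = this
  have "f' \<in> borel_measurable borel" unfolding f'_def by measurable
  moreover have "(f' has_integral (f b - f a)) {a..b}" if ab: "a \<le> b" for a b
  proof -
    obtain X where X: "finite X" "\<And>x. x \<in> {a<..<b} - X \<Longrightarrow> isCont h x" using cont[of a b] by blast
    show ?thesis
    proof (rule fundamental_theorem_of_calculus_interior_strong[OF X(1) ab _ f_cont[OF ab]])
      fix x assume x: "x \<in> {a<..<b} - X"
      have "isCont (\<lambda>u. g u * ?n u) x"
        unfolding g_def by (intro continuous_intros n_cont X(2) x)
      then have "((\<lambda>u. integral {a..u} (\<lambda>u. g u * ?n u)) has_vector_derivative g x * ?n x) (at x within {a..b} - {})"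
        by (intro integral_has_vector_derivative_continuous_at gni)
           (use x in \<open>auto simp: continuous_at_imp_continuous_at_within\<close>)
      then have "((\<lambda>u. I a + integral {a..u} (\<lambda>u. g u * ?n u)) has_vector_derivative g x * ?n x) (at x)"
        using x by (auto simp: at_within_Icc_at intro!: derivative_eq_intros)
      then have I': "(I has_vector_derivative g x * ?n x) (at x)"
        by (rule has_vector_derivative_transform_within_open[where S="{a<..<b}"]) (use x in \<open>auto simp: I_step[symmetric]\<close>)
      have "(f has_real_derivative ((g x * ?n x) * (\<sigma>\<^sup>2 * ?n x) - I x * (\<sigma>\<^sup>2 * - ((x - \<mu>) / \<sigma>\<^sup>2 * ?n x))) / ((\<sigma>\<^sup>2 * ?n x) * (\<sigma>\<^sup>2 * ?n x))) (at x)"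
        unfolding f_def using I' npos[of x] s
        by (intro DERIV_divide DERIV_cmult DERIV_normal_density) (auto simp: has_real_derivative_iff_has_vector_derivative)
      also have "((g x * ?n x) * (\<sigma>\<^sup>2 * ?n x) - I x * (\<sigma>\<^sup>2 * - ((x - \<mu>) / \<sigma>\<^sup>2 * ?n x))) / ((\<sigma>\<^sup>2 * ?n x) * (\<sigma>\<^sup>2 * ?n x)) = f' x"
        using npos[of x] s by (simp add: f'_def f_def divide_simps) (simp add: power2_eq_square algebra_simps)
      finally show "(f has_vector_derivative f' x) (at x)"
        by (simp add: has_real_derivative_iff_has_vector_derivative)
    qed
  qed
  moreover have "\<sigma>\<^sup>2 * f' x = (x - \<mu>) * f x + h x - p" for x using s by (simp add: f'_def g_def)
  ultimately show thesis using that fb f'b \<open>f \<in> borel_measurable borel\<close> by blast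
qed

section \<open>Integrals over random intervals\<close>

text \<open>
  The signed indicator of the interval between \<open>0\<close> and \<open>d\<close>, for \<open>d\<close> of either sign: integrating
  \<open>g(x + t)\<close> against it gives \<open>\<integral> g\<close> from \<open>x\<close> to \<open>x + d\<close>, as an integral over a domain that does not
  depend on \<open>d\<close>. That form is what Fubini's theorem needs when \<open>d\<close> is random.
\<close>

definition increment_kernel :: "real \<Rightarrow> real \<Rightarrow> real" where
  "increment_kernel d t = indicator {0..<d} t - indicator {d..<0} t"

lemma increment_kernel_measurable[measurable]:
  assumes [measurable]: "D \<in> borel_measurable N" "T \<in> borel_measurable N"
  shows "(\<lambda>w. increment_kernel (D w) (T w)) \<in> borel_measurable N"
proof -
  have "increment_kernel d t = (if 0 \<le> t \<and> t < d then 1 else 0) - (if d \<le> t \<and> t < 0 then 1 else 0)" for d t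
    by (simp add: increment_kernel_def indicator_def)
  then show ?thesis by simp
qed

lemma abs_increment_kernel: "\<bar>increment_kernel d t\<bar> = indicator {min 0 d..<max 0 d} t"
  by (auto simp: increment_kernel_def indicator_def)

lemma nn_integral_abs_increment_kernel: "(\<integral>\<^sup>+t. ennreal \<bar>increment_kernel d t\<bar> \<partial>lborel) = ennreal \<bar>d\<bar>"
proof -
  have "(\<integral>\<^sup>+t. ennreal \<bar>increment_kernel d t\<bar> \<partial>lborel) = (\<integral>\<^sup>+t. indicator {min 0 d..<max 0 d} t \<partial>lborel)"
    by (intro nn_integral_cong) (auto simp: abs_increment_kernel indicator_def)
  then show ?thesis by (auto simp: max_def min_def)
qed

lemma nn_integral_abs_increment_kernel_times_abs:
  "(\<integral>\<^sup>+t. ennreal (\<bar>increment_kernel d t\<bar> * \<bar>t\<bar>) \<partial>lborel) = ennreal (d\<^sup>2 / 2)"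
proof -
  \<comment> \<open>The sign of \<open>d\<close>, so that \<open>\<bar>t\<bar> = e * t\<close> between \<open>0\<close> and \<open>d\<close>.\<close>
  define e :: real where "e = (if d \<ge> 0 then 1 else -1)"
  have "AE t in lborel. t \<noteq> max 0 d" by (rule AE_lborel_singleton)
  then have "(\<integral>\<^sup>+t. ennreal (\<bar>increment_kernel d t\<bar> * \<bar>t\<bar>) \<partial>lborel)
      = (\<integral>\<^sup>+t. ennreal (e * t) * indicator {min 0 d..max 0 d} t \<partial>lborel)"
    by (intro nn_integral_cong_AE, elim eventually_mono) (auto simp: abs_increment_kernel indicator_def e_def)
  also have "\<dots> = ennreal (e * (max 0 d)\<^sup>2 / 2 - e * (min 0 d)\<^sup>2 / 2)"
    by (rule nn_integral_FTC_Icc) (auto intro!: derivative_eq_intros simp: e_def max_def min_def mult_nonpos_nonpos split: if_splits)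
  also have "e * (max 0 d)\<^sup>2 / 2 - e * (min 0 d)\<^sup>2 / 2 = d\<^sup>2 / 2"
    by (auto simp: e_def max_def min_def)
  finally show ?thesis .
qed

text \<open>
  Rounding moves \<open>t\<close> by at most a half, which is the origin of the summand \<open>\<bar>GD\<bar>\<close> next to
  \<open>\<bar>GD\<^sup>2\<bar>\<close> in the smoothing term; \<open>d\<close> may be any real number.
\<close>

lemma nn_integral_abs_increment_kernel_times_round:
  "(\<integral>\<^sup>+t. ennreal (\<bar>increment_kernel d t\<bar> * \<bar>real_of_int \<lfloor>t + 1/2\<rfloor>\<bar>) \<partial>lborel) \<le> ennreal ((d\<^sup>2 + \<bar>d\<bar>) / 2)"
proof -
  have r: "\<bar>real_of_int \<lfloor>t + 1/2\<rfloor>\<bar> \<le> \<bar>t\<bar> + 1/2" for t :: real by linarith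
  have "(\<integral>\<^sup>+t. ennreal (\<bar>increment_kernel d t\<bar> * \<bar>real_of_int \<lfloor>t + 1/2\<rfloor>\<bar>) \<partial>lborel)
     \<le> (\<integral>\<^sup>+t. ennreal (\<bar>increment_kernel d t\<bar> * \<bar>t\<bar>) + ennreal (1/2) * ennreal \<bar>increment_kernel d t\<bar> \<partial>lborel)"
  proof (intro nn_integral_mono)
    fix t :: real
    have "\<bar>increment_kernel d t\<bar> * \<bar>real_of_int \<lfloor>t + 1/2\<rfloor>\<bar> \<le> \<bar>increment_kernel d t\<bar> * (\<bar>t\<bar> + 1/2)"
      by (rule mult_left_mono[OF r]) simp
    also have "\<dots> = \<bar>increment_kernel d t\<bar> * \<bar>t\<bar> + 1/2 * \<bar>increment_kernel d t\<bar>" by (simp add: algebra_simps)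
    finally have "ennreal (\<bar>increment_kernel d t\<bar> * \<bar>real_of_int \<lfloor>t + 1/2\<rfloor>\<bar>)
      \<le> ennreal (\<bar>increment_kernel d t\<bar> * \<bar>t\<bar> + 1/2 * \<bar>increment_kernel d t\<bar>)"
      by (rule ennreal_leI)
    also have "\<dots> = ennreal (\<bar>increment_kernel d t\<bar> * \<bar>t\<bar>) + ennreal (1/2 * \<bar>increment_kernel d t\<bar>)"
      by (rule ennreal_plus) auto
    also have "ennreal (1/2 * \<bar>increment_kernel d t\<bar>) = ennreal (1/2) * ennreal \<bar>increment_kernel d t\<bar>"
      by (rule ennreal_mult) auto
    finally show "ennreal (\<bar>increment_kernel d t\<bar> * \<bar>real_of_int \<lfloor>t + 1/2\<rfloor>\<bar>)
      \<le> ennreal (\<bar>increment_kernel d t\<bar> * \<bar>t\<bar>) + ennreal (1/2) * ennreal \<bar>increment_kernel d t\<bar>" .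
  qed
  also have "\<dots> = ennreal (d\<^sup>2 / 2) + ennreal (1/2) * ennreal \<bar>d\<bar>"
    by (subst nn_integral_add) (auto simp: nn_integral_cmult nn_integral_abs_increment_kernel nn_integral_abs_increment_kernel_times_abs)
  also have "ennreal (1/2) * ennreal \<bar>d\<bar> = ennreal (1/2 * \<bar>d\<bar>)" by (rule ennreal_mult[symmetric]) auto
  also have "ennreal (d\<^sup>2 / 2) + ennreal (1/2 * \<bar>d\<bar>) = ennreal (d\<^sup>2 / 2 + 1/2 * \<bar>d\<bar>)"
    by (rule ennreal_plus[symmetric]) auto
  also have "d\<^sup>2 / 2 + 1/2 * \<bar>d\<bar> = (d\<^sup>2 + \<bar>d\<bar>) / 2" by (simp add: field_simps)
  finally show ?thesis .
qed

lemma integrable_increment_kernel: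
  assumes g[measurable]: "g \<in> borel_measurable borel" and b: "\<And>t. \<bar>g t\<bar> \<le> (B::real)"
  shows "integrable lborel (\<lambda>t. increment_kernel d t * g t)"
proof (rule Bochner_Integration.integrable_bound)
  have "integrable lborel (indicator {min 0 d..<max 0 d} :: real \<Rightarrow> real)" by (auto simp: less_top[symmetric])
  then show "integrable lborel (\<lambda>t. B * indicator {min 0 d..<max 0 d} t)" by simp
  show "AE t in lborel. norm (increment_kernel d t * g t) \<le> norm (B * indicator {min 0 d..<max 0 d} t)"
    using order_trans[OF b abs_ge_self] by (auto simp: abs_mult abs_increment_kernel indicator_def)
qed auto

lemma increment_kernel_FTC:
  assumes g[measurable]: "g \<in> borel_measurable borel" and b: "\<And>t. \<bar>g t\<bar> \<le> (B::real)"
    and ftc: "\<And>a b. a \<le> b \<Longrightarrow> (g has_integral (f b - f a)) {a..b}"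
  shows "(\<integral>t. increment_kernel d t * g (x + t) \<partial>lborel) = f (x + d) - f x"
proof -
  have LB: "(\<integral>u. indicator {a..b} u * g u \<partial>lborel) = f b - f a" if "a \<le> b" for a b
  proof -
    have "integrable lborel (\<lambda>u. indicator {a..b} u * g u)"
    proof (rule Bochner_Integration.integrable_bound)
      have "integrable lborel (indicator {a..b} :: real \<Rightarrow> real)"
        by (intro integrable_real_indicator) (auto simp: emeasure_lborel_Icc_eq)
      then show "integrable lborel (\<lambda>t. B * indicator {a..b} t)" by simp
      show "AE t in lborel. norm (indicator {a..b} t * g t) \<le> norm (B * indicator {a..b} t)"
        using order_trans[OF b abs_ge_self] by (auto simp: abs_mult indicator_def)
    qed auto
    then have "(\<integral>u. indicator {a..b} u * g u \<partial>lborel) = integral {a..b} g"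
      using set_borel_integral_eq_integral(2)[of "{a..b}" g]
      by (simp add: set_integrable_def set_lebesgue_integral_def)
    then show ?thesis using ftc[OF that] by (simp add: integral_unique)
  qed
  have shift: "(\<integral>t. indicator {a..b} t * g (x + t) \<partial>lborel) = f (x + b) - f (x + a)" if "a \<le> b" for a b
  proof -
    have "(\<integral>t. indicator {a..b} t * g (x + t) \<partial>lborel) = (\<integral>t. indicator {x+a..x+b} (x + 1 * t) * g (x + 1 * t) \<partial>lborel)"
      by (intro Bochner_Integration.integral_cong) (auto simp: indicator_def)
    also have "\<dots> = (\<integral>u. indicator {x+a..x+b} u * g u \<partial>lborel)"
      using lborel_integral_real_affine[of 1 "\<lambda>u. indicator {x+a..x+b} u * g u" x] by simp
    finally show ?thesis using LB[of "x+a" "x+b"] that by simp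
  qed
  show ?thesis
  proof (cases "0 \<le> d")
    case True
    have "(\<integral>t. increment_kernel d t * g (x + t) \<partial>lborel) = (\<integral>t. indicator {0..d} t * g (x + t) \<partial>lborel)"
      by (rule integral_cong_AE, measurable)
         (use True AE_lborel_singleton[of d] in \<open>auto elim!: eventually_mono simp: indicator_def increment_kernel_def\<close>)
    then show ?thesis using shift[OF True] by simp
  next
    case False
    have "(\<integral>t. increment_kernel d t * g (x + t) \<partial>lborel) = (\<integral>t. - (indicator {d..0} t * g (x + t)) \<partial>lborel)"
      by (rule integral_cong_AE, measurable)
         (use False AE_lborel_singleton[of 0] in \<open>auto elim!: eventually_mono simp: indicator_def increment_kernel_def\<close>)
    then show ?thesis using shift[of d 0] False by simp
  qed
qed

text \<open>
  By the Stein equation, \<open>\<sigma>\<^sup>2 (f'(x + t) - f'(x))\<close> is the increment of \<open>h\<close> plus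
  \<open>(x - \<mu>) (f(x + t) - f(x)) + t f(x + t)\<close>. The second part is at most a constant times \<open>\<bar>t\<bar>\<close>, as \<open>f\<close> is
  bounded and Lipschitz, and \<open>\<integral> \<bar>t\<bar>\<close> between \<open>0\<close> and \<open>d\<close> is \<open>d\<^sup>2 / 2\<close>; the bound on \<open>f\<close> thus enters as \<open>\<surd>(\<pi>/2) / 2 = \<surd>(\<pi>/8)\<close>.
  The increment of \<open>h\<close> need not be small pointwise; it stays in the statement, to be controlled in
  the mean.
\<close>

lemma stein_solution_taylor:
  fixes f f' h :: "real \<Rightarrow> real"
  assumes s: "\<sigma> > 0" and [measurable]: "f \<in> borel_measurable borel" "f' \<in> borel_measurable borel" "h \<in> borel_measurable borel"
    and h01: "\<And>u. 0 \<le> h u \<and> h u \<le> 1"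
    and eq: "\<And>x. \<sigma>\<^sup>2 * f' x = (x - \<mu>) * f x + h x - p"
    and fb: "\<And>x. \<bar>f x\<bar> \<le> sqrt (pi / 2) / \<sigma>" and f'b: "\<And>x. \<bar>f' x\<bar> \<le> 2 / \<sigma>\<^sup>2"
    and ftc: "\<And>a b. a \<le> b \<Longrightarrow> (f' has_integral (f b - f a)) {a..b}"
  shows "\<bar>f (x + d) - f x - d * f' x - (\<integral>t. increment_kernel d t * (h (x + t) - h x) \<partial>lborel) / \<sigma>\<^sup>2\<bar>
     \<le> d\<^sup>2 * \<bar>x - \<mu>\<bar> / \<sigma> ^ 4 + sqrt (pi / 8) * d\<^sup>2 / \<sigma> ^ 3"
proof -
  define c where "c = (2 * \<bar>x - \<mu>\<bar> / \<sigma>\<^sup>2 + sqrt (pi / 2) / \<sigma>) / \<sigma>\<^sup>2"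
  have c0: "c \<ge> 0" using s by (simp add: c_def)
  have lip: "\<bar>f (x + t) - f x\<bar> \<le> 2 / \<sigma>\<^sup>2 * \<bar>t\<bar>" for x t
  proof -
    have "ennreal \<bar>f (x + t) - f x\<bar> \<le> (\<integral>\<^sup>+u. ennreal \<bar>increment_kernel t u * f' (x + u)\<bar> \<partial>lborel)"
      using ennreal_abs_integral_le[of lborel "\<lambda>u. increment_kernel t u * f' (x + u)"]
      by (simp add: increment_kernel_FTC[OF _ f'b ftc])
    also have "\<dots> \<le> (\<integral>\<^sup>+u. ennreal (2 / \<sigma>\<^sup>2) * ennreal \<bar>increment_kernel t u\<bar> \<partial>lborel)"
      using f'b s by (intro nn_integral_mono)
         (subst ennreal_mult[symmetric], simp, simp, auto simp: abs_mult abs_increment_kernel indicator_def intro!: ennreal_leI)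
    also have "\<dots> = ennreal (2 / \<sigma>\<^sup>2 * \<bar>t\<bar>)"
      by (subst nn_integral_cmult, simp, unfold nn_integral_abs_increment_kernel, rule ennreal_mult[symmetric]) auto
    finally show ?thesis using s by (subst (asm) ennreal_le_iff) auto
  qed
  define r where "r t = f' (x + t) - f' x - (h (x + t) - h x) / \<sigma>\<^sup>2" for t
  have r: "\<bar>r t\<bar> \<le> c * \<bar>t\<bar>" for t
  proof -
    have "\<sigma>\<^sup>2 * r t = \<sigma>\<^sup>2 * f' (x + t) - \<sigma>\<^sup>2 * f' x - (h (x + t) - h x)"
      using s by (simp only: r_def right_diff_distrib) simp
    also have "\<dots> = (x - \<mu>) * (f (x + t) - f x) + t * f (x + t)"
      unfolding eq by (simp add: algebra_simps)
    finally have "\<bar>\<sigma>\<^sup>2 * r t\<bar> \<le> \<bar>x - \<mu>\<bar> * \<bar>f (x + t) - f x\<bar> + \<bar>t\<bar> * \<bar>f (x + t)\<bar>"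
      by (simp add: abs_triangle_ineq[THEN order_trans] abs_mult)
    also have "\<dots> \<le> \<bar>x - \<mu>\<bar> * (2 / \<sigma>\<^sup>2 * \<bar>t\<bar>) + \<bar>t\<bar> * (sqrt (pi / 2) / \<sigma>)"
      by (intro add_mono mult_left_mono lip fb) auto
    also have "\<dots> = (\<sigma>\<^sup>2 * c) * \<bar>t\<bar>"
    proof -
      have "\<sigma>\<^sup>2 * c = 2 * \<bar>x - \<mu>\<bar> / \<sigma>\<^sup>2 + sqrt (pi / 2) / \<sigma>" using s by (simp add: c_def)
      then show ?thesis by (simp add: algebra_simps)
    qed
    finally show ?thesis using s by (simp add: abs_mult)
  qed
  have i1: "integrable lborel (\<lambda>t. increment_kernel d t * f' (x + t))"
    by (rule integrable_increment_kernel[where B="2/\<sigma>\<^sup>2"]) (use f'b in auto)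
  have i2: "integrable lborel (\<lambda>t. increment_kernel d t * f' x)"
    by (rule integrable_increment_kernel[where B="2/\<sigma>\<^sup>2"]) (use f'b in auto)
  have hd: "\<bar>h u - h v\<bar> \<le> 1" for u v using h01[of u] h01[of v] by auto
  have i3: "integrable lborel (\<lambda>t. increment_kernel d t * (h (x + t) - h x))"
    by (rule integrable_increment_kernel[where B=1]) (use hd in auto)
  have const: "(\<integral>t. increment_kernel d t \<partial>lborel) = d"
  proof -
    have "((\<lambda>_. 1 :: real) has_integral (b - a)) {a..b}" if "a \<le> b" for a b :: real
      using has_integral_const_real[of "1 :: real" a b] that by simp
    then show ?thesis
      using increment_kernel_FTC[where g="\<lambda>_. 1" and B=1 and f="\<lambda>u. u" and d=d and x=0] by simp
  qed
  have "(\<integral>t. increment_kernel d t * r t \<partial>lborel)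
      = (\<integral>t. increment_kernel d t * f' (x + t) - increment_kernel d t * f' x - (increment_kernel d t * (h (x + t) - h x)) / \<sigma>\<^sup>2 \<partial>lborel)"
    by (simp add: r_def algebra_simps diff_divide_distrib)
  also have "\<dots> = f (x + d) - f x - d * f' x - (\<integral>t. increment_kernel d t * (h (x + t) - h x) \<partial>lborel) / \<sigma>\<^sup>2"
    using i1 i2 i3 by (simp add: const increment_kernel_FTC[OF _ f'b ftc])
  finally have "ennreal \<bar>f (x + d) - f x - d * f' x - (\<integral>t. increment_kernel d t * (h (x + t) - h x) \<partial>lborel) / \<sigma>\<^sup>2\<bar>
      \<le> (\<integral>\<^sup>+t. ennreal \<bar>increment_kernel d t * r t\<bar> \<partial>lborel)"
    using ennreal_abs_integral_le[of lborel "\<lambda>t. increment_kernel d t * r t"] by simp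
  also have "\<dots> \<le> (\<integral>\<^sup>+t. ennreal c * ennreal (\<bar>increment_kernel d t\<bar> * \<bar>t\<bar>) \<partial>lborel)"
    using r c0 by (intro nn_integral_mono)
       (subst ennreal_mult[symmetric], simp, simp, auto simp: abs_mult abs_increment_kernel indicator_def intro!: ennreal_leI)
  also have "\<dots> = ennreal (c * (d\<^sup>2 / 2))"
    by (subst nn_integral_cmult, simp, unfold nn_integral_abs_increment_kernel_times_abs,
        rule ennreal_mult[symmetric]) (use c0 in auto)
  finally have "\<bar>f (x + d) - f x - d * f' x - (\<integral>t. increment_kernel d t * (h (x + t) - h x) \<partial>lborel) / \<sigma>\<^sup>2\<bar> \<le> c * (d\<^sup>2 / 2)"
    using c0 by (subst (asm) ennreal_le_iff) auto
  also have "\<dots> = d\<^sup>2 * \<bar>x - \<mu>\<bar> / \<sigma> ^ 4 + (sqrt (pi / 2) / 2) * d\<^sup>2 / \<sigma> ^ 3"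
    using s by (simp add: c_def field_simps power2_eq_square power3_eq_cube power4_eq_xxxx)
  also have "sqrt (pi / 2) / 2 = sqrt (pi / 8)"
  proof -
    have "sqrt (4 * (pi / 8)) = sqrt 4 * sqrt (pi / 8)" by (rule real_sqrt_mult)
    moreover have "4 * (pi / 8) = pi / 2" by simp
    ultimately show ?thesis by (simp only: real_sqrt_four)
  qed
  finally show ?thesis .
qed

section \<open>Rounding to the nearest integer\<close>

text \<open>
  The indicator of \<open>A\<close> evaluated at the integer whose cell contains \<open>x\<close>. It agrees with the
  indicator of \<open>A\<close> on the integers and its normal mean is the mass that \<open>N\<^sup>d(\<mu>, \<sigma>\<^sup>2)\<close> gives to \<open>A\<close>, which
  makes it the right test function for the Stein equation.
\<close>

definition cell_round :: "real set \<Rightarrow> real \<Rightarrow> real" where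
  "cell_round A x = indicator A (real_of_int \<lfloor>x + 1/2\<rfloor>)"

lemma cell_round_measurable[measurable]: "A \<in> sets borel \<Longrightarrow> cell_round A \<in> borel_measurable borel"
  unfolding cell_round_def by measurable

lemma cell_round_int_add:
  assumes "x \<in> \<int>"
  shows "cell_round A (x + t) = indicator A (x + real_of_int \<lfloor>t + 1/2\<rfloor>)" and "cell_round A x = indicator A x"
proof -
  obtain k where k: "x = real_of_int k" using assms by (auto elim: Ints_cases)
  have *: "cell_round A (x + t) = indicator A (x + real_of_int \<lfloor>t + 1/2\<rfloor>)" for t
  proof -
    have "\<lfloor>x + t + 1/2\<rfloor> = k + \<lfloor>t + 1/2\<rfloor>" unfolding k using int_add_floor[of k "t + 1/2"] by (simp add: add_ac)
    then show ?thesis by (simp add: cell_round_def k)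
  qed
  show "cell_round A (x + t) = indicator A (x + real_of_int \<lfloor>t + 1/2\<rfloor>)" by (rule *)
  show "cell_round A x = indicator A x" using *[of 0] by simp
qed

lemma cell_round_finite_discontinuities:
  "\<exists>X. finite X \<and> (\<forall>x\<in>{a<..<b} - X. isCont (cell_round A) x)"
proof (intro exI[of _ "(\<lambda>z. real_of_int z - 1/2) ` {\<lfloor>a\<rfloor>..\<lceil>b\<rceil> + 1}"] conjI ballI)
  fix x assume x: "x \<in> {a<..<b} - (\<lambda>z. real_of_int z - 1/2) ` {\<lfloor>a\<rfloor>..\<lceil>b\<rceil> + 1}"
  have "x + 1/2 \<notin> \<int>"
  proof
    assume "x + 1/2 \<in> \<int>"
    then obtain z where z: "x + 1/2 = real_of_int z" by (auto elim: Ints_cases)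
    have "x = real_of_int z - 1/2" using z by linarith
    moreover have "z \<in> {\<lfloor>a\<rfloor>..\<lceil>b\<rceil> + 1}" using z x by simp linarith
    ultimately show False using x by blast
  qed
  then have "eventually (\<lambda>u. \<lfloor>u + 1/2\<rfloor> = \<lfloor>x + 1/2\<rfloor>) (nhds x)"
    by (intro eventually_floor_eq[OF tendsto_add[OF filterlim_ident tendsto_const]])
  then have "eventually (\<lambda>u. cell_round A u = cell_round A x) (nhds x)"
    by eventually_elim (simp add: cell_round_def)
  then show "isCont (cell_round A) x" by (simp cong: isCont_cong)
qed simp

lemma measure_discretized_normal:
  assumes s: "\<sigma> > 0" and A[measurable]: "A \<in> sets borel"
  shows "measure (discretized_normal \<mu> \<sigma>) A = (\<integral>u. cell_round A u * normal_density \<mu> \<sigma> u \<partial>lborel)"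
proof -
  let ?N = "density lborel (normal_density \<mu> \<sigma>)"
  let ?C = "\<lambda>z. {real_of_int z - 1 / 2 ..< real_of_int z + 1 / 2}"
  define B where "B = {u :: real. real_of_int \<lfloor>u + 1/2\<rfloor> \<in> A}"
  have B[measurable]: "B \<in> sets borel" unfolding B_def by measurable
  have cell: "u \<in> ?C z \<longleftrightarrow> \<lfloor>u + 1/2\<rfloor> = z" for u z by (auto simp: floor_eq_iff)
  have BU: "B = (\<Union>z. if real_of_int z \<in> A then ?C z else {})" (is "_ = (\<Union>z. ?E z)")
  proof (rule set_eqI)
    fix u
    have "u \<in> (\<Union>z. ?E z) \<longleftrightarrow> (\<exists>z. real_of_int z \<in> A \<and> u \<in> ?C z)" by auto
    also have "\<dots> \<longleftrightarrow> u \<in> B" unfolding cell by (auto simp: B_def)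
    finally show "u \<in> B \<longleftrightarrow> u \<in> (\<Union>z. ?E z)" by simp
  qed
  have "emeasure (discretized_normal \<mu> \<sigma>) A = (\<integral>\<^sup>+z. emeasure ?N (?E z) \<partial>count_space UNIV)"
    unfolding discretized_normal_def by (subst emeasure_distr_point_measure_int) (auto intro!: nn_integral_cong)
  also have "\<dots> = emeasure ?N (\<Union>z. ?E z)"
    by (rule emeasure_UN_countable[symmetric]) (use int_cells(2) in \<open>auto simp: disjoint_family_on_def\<close>)
  finally have "measure (discretized_normal \<mu> \<sigma>) A = measure ?N B" by (simp add: measure_def BU)
  also have "\<dots> = (\<integral>u. indicator B u \<partial>?N)" by simp
  also have "\<dots> = (\<integral>u. normal_density \<mu> \<sigma> u * indicator B u \<partial>lborel)"
    using s by (subst integral_density) auto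
  also have "\<dots> = (\<integral>u. cell_round A u * normal_density \<mu> \<sigma> u \<partial>lborel)"
    by (intro Bochner_Integration.integral_cong) (auto simp: cell_round_def B_def indicator_def)
  finally show ?thesis .
qed

section \<open>The smoothing term\<close>

lemma abs_measure_diff_le_tv_dist:
  assumes "prob_space P" "prob_space Q" "A \<in> sets borel"
  shows "\<bar>measure P A - measure Q A\<bar> \<le> tv_dist P Q"
proof -
  interpret P: prob_space P by fact
  interpret Q: prob_space Q by fact
  show ?thesis unfolding tv_dist_def
  proof (rule cSUP_upper[OF assms(3)])
    have "\<bar>measure P A - measure Q A\<bar> \<le> 1" for A
      using P.prob_le_1[of A] Q.prob_le_1[of A] measure_nonneg[of P A] measure_nonneg[of Q A] by linarith
    then show "bdd_above ((\<lambda>A. \<bar>measure P A - measure Q A\<bar>) ` sets borel)"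
      by (auto intro!: bdd_aboveI[where M=1])
  qed
qed

lemma abs_int_shift_le:
  fixes a :: "int \<Rightarrow> real" and C :: ennreal
  assumes "\<And>k. ennreal \<bar>a (k + 1) - a k\<bar> \<le> C"
  shows "ennreal \<bar>a n - a 0\<bar> \<le> ennreal \<bar>real_of_int n\<bar> * C"
proof (cases C)
  case (real c)
  have step: "\<bar>a (k + 1) - a k\<bar> \<le> c" for k using assms[of k] real by simp
  have "\<bar>a n - a 0\<bar> \<le> \<bar>real_of_int n\<bar> * c"
  proof (induction n rule: int_induct[where k=0])
    case base then show ?case by simp
  next
    case (step1 i) then show ?case using step[of i] by (simp add: algebra_simps)
  next
    case (step2 i) then show ?case using step[of "i - 1"] by (simp add: algebra_simps)
  qed
  then show ?thesis using real by (simp add: ennreal_mult[symmetric] ennreal_leI)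
next
  case top
  then show ?thesis by (cases "n = 0") (auto simp: ennreal_mult_top)
qed

text \<open>
  Conditionally on \<open>\<F>\<close>, shifting \<open>S\<close> by \<open>n\<close> is \<open>\<bar>n\<bar>\<close> unit shifts, each of which changes a probability
  by at most the total variation distance between the laws of \<open>S\<close> and \<open>S + 1\<close>. That distance
  is a supremum over uncountably many sets, and \<open>\<tau>\<close> restricts it to the integer translates of \<open>A\<close>,
  which are all that occur; being a countable supremum, it is visibly measurable.
\<close>

lemma regular_cond_distr_shift_bound:
  assumes M: "prob_space M" and sub: "subalgebra M F"
    and S[measurable]: "S \<in> borel_measurable M" and A[measurable]: "A \<in> sets borel"
    and K: "regular_cond_distr M F S K" and K1: "regular_cond_distr M F (\<lambda>\<omega>. S \<omega> + 1) K1"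
  obtains \<tau> :: "'a \<Rightarrow> ennreal" where "\<tau> \<in> borel_measurable F" "AE \<omega> in M. \<tau> \<omega> \<le> ennreal (tv_dist (K \<omega>) (K1 \<omega>))"
    "\<And>X n. X \<in> borel_measurable F \<Longrightarrow> integrable M X \<Longrightarrow>
       ennreal \<bar>\<integral>\<omega>. X \<omega> * (indicator A (S \<omega> + real_of_int n) - indicator A (S \<omega>)) \<partial>M\<bar>
       \<le> (\<integral>\<^sup>+\<omega>. ennreal \<bar>X \<omega>\<bar> * (ennreal \<bar>real_of_int n\<bar> * \<tau> \<omega>) \<partial>M)"
proof -
  interpret prob_space M by fact
  interpret finite_measure_subalgebra M F using sub by unfold_locales
  \<comment> \<open>Both \<open>S + (k + 1) \<in> A\<close> and \<open>(S + 1) + k \<in> A\<close> say the same, so \<open>K (B (k + 1)) = K1 (B k)\<close> almost surely.\<close>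
  define B where "B k = {x. x + real_of_int k \<in> A}" for k :: int
  have B[measurable]: "B k \<in> sets borel" for k unfolding B_def by measurable
  define a where "a \<omega> k = measure (K \<omega>) (B k)" for \<omega> k
  have "K \<in> measurable F (prob_algebra borel)" "K1 \<in> measurable F (prob_algebra borel)"
    using K K1 by (auto simp: regular_cond_distr_def)
  note KF = this
  have [measurable]: "K \<in> measurable F (subprob_algebra borel)"
    using KF(1) by (rule measurable_prob_algebraD)
  have aF[measurable]: "(\<lambda>\<omega>. a \<omega> k) \<in> borel_measurable F" for k unfolding a_def by measurable
  define \<tau> where "\<tau> \<omega> = (SUP k. ennreal \<bar>a \<omega> (k + 1) - a \<omega> k\<bar>)" for \<omega>
  have \<tau>[measurable]: "\<tau> \<in> borel_measurable F" unfolding \<tau>_def by measurable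
  have ae: "AE \<omega> in M. a \<omega> k = real_cond_exp M F (\<lambda>\<omega>'. indicator A (S \<omega>' + real_of_int k)) \<omega>" for k
  proof -
    have "(\<lambda>\<omega>'. indicator (B k) (S \<omega>')) = (\<lambda>\<omega>'. indicator A (S \<omega>' + real_of_int k) :: real)"
      by (auto simp: B_def indicator_def)
    then show ?thesis using K B[of k] unfolding regular_cond_distr_def a_def by metis
  qed
  have ae1: "AE \<omega> in M. measure (K1 \<omega>) (B k) = real_cond_exp M F (\<lambda>\<omega>'. indicator A (S \<omega>' + real_of_int (k + 1))) \<omega>" for k
  proof -
    have "(\<lambda>\<omega>'. indicator (B k) (S \<omega>' + 1)) = (\<lambda>\<omega>'. indicator A (S \<omega>' + real_of_int (k + 1)) :: real)"
      by (auto simp: B_def indicator_def add_ac)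
    then show ?thesis using K1 B[of k] unfolding regular_cond_distr_def by metis
  qed
  have "AE \<omega> in M. \<forall>k. a \<omega> (k + 1) = measure (K1 \<omega>) (B k)"
    unfolding AE_all_countable
  proof
    fix k show "AE \<omega> in M. a \<omega> (k + 1) = measure (K1 \<omega>) (B k)"
      using ae[of "k + 1"] ae1[of k] by eventually_elim simp
  qed
  then have tv: "AE \<omega> in M. \<tau> \<omega> \<le> ennreal (tv_dist (K \<omega>) (K1 \<omega>))"
  proof (rule AE_mp, intro AE_I2 impI)
    fix \<omega> assume w: "\<omega> \<in> space M" and eq: "\<forall>k. a \<omega> (k + 1) = measure (K1 \<omega>) (B k)"
    have "\<omega> \<in> space F" using w sub by (simp add: subalgebra_def)
    then have "K \<omega> \<in> space (prob_algebra borel)" "K1 \<omega> \<in> space (prob_algebra borel)"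
      using KF by (auto intro: measurable_space)
    then have pr: "prob_space (K \<omega>)" "prob_space (K1 \<omega>)" by (auto simp: space_prob_algebra)
    have "\<bar>a \<omega> (k + 1) - a \<omega> k\<bar> \<le> tv_dist (K \<omega>) (K1 \<omega>)" for k
      using abs_measure_diff_le_tv_dist[OF pr, of "B k"] eq B by (simp add: a_def abs_minus_commute)
    then show "\<tau> \<omega> \<le> ennreal (tv_dist (K \<omega>) (K1 \<omega>))"
      unfolding \<tau>_def by (intro SUP_least ennreal_leI)
  qed
  have bound: "ennreal \<bar>\<integral>\<omega>. X \<omega> * (indicator A (S \<omega> + real_of_int n) - indicator A (S \<omega>)) \<partial>M\<bar>
       \<le> (\<integral>\<^sup>+\<omega>. ennreal \<bar>X \<omega>\<bar> * (ennreal \<bar>real_of_int n\<bar> * \<tau> \<omega>) \<partial>M)"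
    if X[measurable]: "X \<in> borel_measurable F" and iX: "integrable M X" for X n
  proof -
    have XM[measurable]: "X \<in> borel_measurable M" using sub X by (rule measurable_from_subalg)
    let ?Y = "\<lambda>k \<omega>. indicator A (S \<omega> + real_of_int k) :: real"
    have iY: "integrable M (\<lambda>\<omega>. X \<omega> * ?Y k \<omega>)" for k
      by (rule Bochner_Integration.integrable_bound[OF iX]) (auto simp: indicator_def)
    have cY: "(\<integral>\<omega>. X \<omega> * ?Y k \<omega> \<partial>M) = (\<integral>\<omega>. X \<omega> * a \<omega> k \<partial>M)" and iA: "integrable M (\<lambda>\<omega>. X \<omega> * a \<omega> k)" for k
    proof -
      have aM: "(\<lambda>\<omega>. a \<omega> k) \<in> borel_measurable M" using sub aF by (rule measurable_from_subalg)
      have e: "AE \<omega> in M. X \<omega> * real_cond_exp M F (?Y k) \<omega> = X \<omega> * a \<omega> k" using ae[of k] by eventually_elim simp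
      note c = real_cond_exp_intg[OF iY X, of k]
      have "(\<integral>\<omega>. X \<omega> * real_cond_exp M F (?Y k) \<omega> \<partial>M) = (\<integral>\<omega>. X \<omega> * a \<omega> k \<partial>M)"
        using e aM by (intro integral_cong_AE) auto
      then show "(\<integral>\<omega>. X \<omega> * ?Y k \<omega> \<partial>M) = (\<integral>\<omega>. X \<omega> * a \<omega> k \<partial>M)" using c(2) by simp
      show "integrable M (\<lambda>\<omega>. X \<omega> * a \<omega> k)"
        using c(1) e aM by (subst integrable_cong_AE[where g="\<lambda>\<omega>. X \<omega> * real_cond_exp M F (?Y k) \<omega>"]) (auto elim: eventually_mono)
    qed
    have "(\<integral>\<omega>. X \<omega> * (?Y n \<omega> - indicator A (S \<omega>)) \<partial>M) = (\<integral>\<omega>. X \<omega> * ?Y n \<omega> - X \<omega> * ?Y 0 \<omega> \<partial>M)"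
      by (simp add: right_diff_distrib)
    also have "\<dots> = (\<integral>\<omega>. X \<omega> * a \<omega> n - X \<omega> * a \<omega> 0 \<partial>M)"
      by (subst (1 2) Bochner_Integration.integral_diff) (auto simp only: iY iA cY)
    also have "\<dots> = (\<integral>\<omega>. X \<omega> * (a \<omega> n - a \<omega> 0) \<partial>M)" by (simp add: right_diff_distrib)
    finally have "ennreal \<bar>\<integral>\<omega>. X \<omega> * (?Y n \<omega> - indicator A (S \<omega>)) \<partial>M\<bar> \<le> (\<integral>\<^sup>+\<omega>. ennreal \<bar>X \<omega> * (a \<omega> n - a \<omega> 0)\<bar> \<partial>M)"
      using ennreal_abs_integral_le[of M "\<lambda>\<omega>. X \<omega> * (a \<omega> n - a \<omega> 0)"] by simp
    also have "\<dots> \<le> (\<integral>\<^sup>+\<omega>. ennreal \<bar>X \<omega>\<bar> * (ennreal \<bar>real_of_int n\<bar> * \<tau> \<omega>) \<partial>M)"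
    proof (rule nn_integral_mono)
      fix \<omega>
      have "ennreal \<bar>a \<omega> n - a \<omega> 0\<bar> \<le> ennreal \<bar>real_of_int n\<bar> * \<tau> \<omega>"
        by (rule abs_int_shift_le) (auto simp: \<tau>_def intro: SUP_upper)
      then show "ennreal \<bar>X \<omega> * (a \<omega> n - a \<omega> 0)\<bar> \<le> ennreal \<bar>X \<omega>\<bar> * (ennreal \<bar>real_of_int n\<bar> * \<tau> \<omega>)"
        by (simp add: abs_mult ennreal_mult mult_left_mono)
    qed
    finally show ?thesis .
  qed
  show thesis by (rule that[OF \<tau> tv bound])
qed

text \<open>
  For each fixed \<open>t\<close>, rounding turns the shift of the integer \<open>S\<close> by \<open>t\<close> into a shift by the constant
  integer \<open>\<lfloor>t + 1/2\<rfloor>\<close>, while \<open>G\<close> and the kernel are \<open>\<F>\<close>-measurable factors. Exchanging the two integrals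
  therefore reduces the claim to deterministic shifts, before any conditioning takes place.
\<close>

lemma smoothing_term_bound:
  assumes M: "prob_space M" and sub: "subalgebra M F"
    and S[measurable]: "S \<in> borel_measurable M" and int: "AE \<omega> in M. S \<omega> \<in> \<int>" and A[measurable]: "A \<in> sets borel"
    and K: "regular_cond_distr M F S K" and K1: "regular_cond_distr M F (\<lambda>\<omega>. S \<omega> + 1) K1"
    and GF: "G \<in> borel_measurable F" and DF: "D \<in> borel_measurable F"
    and iG: "integrable M G" and iGD: "integrable M (\<lambda>\<omega>. G \<omega> * D \<omega>)"
  shows "ennreal \<bar>\<integral>\<omega>. G \<omega> * (\<integral>t. increment_kernel (D \<omega>) t * (cell_round A (S \<omega> + t) - cell_round A (S \<omega>)) \<partial>lborel) \<partial>M\<bar>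
      \<le> ennreal (1/2) * (\<integral>\<^sup>+\<omega>. ennreal ((\<bar>G \<omega> * (D \<omega>)\<^sup>2\<bar> + \<bar>G \<omega> * D \<omega>\<bar>) * tv_dist (K \<omega>) (K1 \<omega>)) \<partial>M)"
    and "integrable M (\<lambda>\<omega>. G \<omega> * (\<integral>t. increment_kernel (D \<omega>) t * (cell_round A (S \<omega> + t) - cell_round A (S \<omega>)) \<partial>lborel))"
proof -
  interpret prob_space M by fact
  interpret PS: pair_sigma_finite M lborel by unfold_locales
  note [measurable] = measurable_from_subalg[OF sub GF] measurable_from_subalg[OF sub DF]
  obtain \<tau> where tF: "\<tau> \<in> borel_measurable F" and tau_tv: "AE \<omega> in M. \<tau> \<omega> \<le> ennreal (tv_dist (K \<omega>) (K1 \<omega>))"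
    and tau: "\<And>X n. X \<in> borel_measurable F \<Longrightarrow> integrable M X \<Longrightarrow>
       ennreal \<bar>\<integral>\<omega>. X \<omega> * (indicator A (S \<omega> + real_of_int n) - indicator A (S \<omega>)) \<partial>M\<bar>
       \<le> (\<integral>\<^sup>+\<omega>. ennreal \<bar>X \<omega>\<bar> * (ennreal \<bar>real_of_int n\<bar> * \<tau> \<omega>) \<partial>M)"
    using regular_cond_distr_shift_bound[OF M sub S A K K1] by blast
  note [measurable] = measurable_from_subalg[OF sub tF]
  define \<phi> where "\<phi> \<omega> t = G \<omega> * (increment_kernel (D \<omega>) t * (cell_round A (S \<omega> + t) - cell_round A (S \<omega>)))" for \<omega> t
  have cr: "\<bar>cell_round A x - cell_round A y\<bar> \<le> 1" for x y by (auto simp: cell_round_def indicator_def)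
  have \<phi>_m[measurable]: "(\<lambda>(\<omega>, t). \<phi> \<omega> t) \<in> borel_measurable (M \<Otimes>\<^sub>M lborel)"
    unfolding \<phi>_def split_beta by measurable
  have \<phi>_i: "integrable (M \<Otimes>\<^sub>M lborel) (\<lambda>(\<omega>, t). \<phi> \<omega> t)"
  proof (rule integrableI_bounded)
    have "(\<integral>\<^sup>+x. ennreal (norm (case x of (\<omega>, t) \<Rightarrow> \<phi> \<omega> t)) \<partial>(M \<Otimes>\<^sub>M lborel))
        = (\<integral>\<^sup>+\<omega>. (\<integral>\<^sup>+t. ennreal \<bar>\<phi> \<omega> t\<bar> \<partial>lborel) \<partial>M)"
      by (subst lborel.nn_integral_fst[symmetric]) auto
    also have "\<dots> \<le> (\<integral>\<^sup>+\<omega>. (\<integral>\<^sup>+t. ennreal \<bar>G \<omega>\<bar> * ennreal \<bar>increment_kernel (D \<omega>) t\<bar> \<partial>lborel) \<partial>M)"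
      using cr by (intro nn_integral_mono)
         (auto simp: \<phi>_def abs_mult ennreal_mult[symmetric] intro!: ennreal_leI mult_left_mono mult_right_le_one_le)
    also have "\<dots> = (\<integral>\<^sup>+\<omega>. ennreal \<bar>G \<omega> * D \<omega>\<bar> \<partial>M)"
      by (simp add: nn_integral_cmult nn_integral_abs_increment_kernel abs_mult ennreal_mult)
    also have "\<dots> < \<infinity>" using iGD by (simp add: integrable_iff_bounded)
    finally show "(\<integral>\<^sup>+x. ennreal (norm (case x of (\<omega>, t) \<Rightarrow> \<phi> \<omega> t)) \<partial>(M \<Otimes>\<^sub>M lborel)) < \<infinity>" .
  qed measurable
  have G_in: "(\<lambda>\<omega>. G \<omega> * (\<integral>t. increment_kernel (D \<omega>) t * (cell_round A (S \<omega> + t) - cell_round A (S \<omega>)) \<partial>lborel))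
      = (\<lambda>\<omega>. \<integral>t. \<phi> \<omega> t \<partial>lborel)"
    by (simp add: \<phi>_def)
  show "integrable M (\<lambda>\<omega>. G \<omega> * (\<integral>t. increment_kernel (D \<omega>) t * (cell_round A (S \<omega> + t) - cell_round A (S \<omega>)) \<partial>lborel))"
    unfolding G_in using PS.integrable_fst[OF \<phi>_i] .
  have slice: "ennreal \<bar>\<integral>\<omega>. \<phi> \<omega> t \<partial>M\<bar>
      \<le> (\<integral>\<^sup>+\<omega>. ennreal (\<bar>G \<omega>\<bar> * \<bar>increment_kernel (D \<omega>) t\<bar>) * (ennreal \<bar>real_of_int \<lfloor>t + 1/2\<rfloor>\<bar> * \<tau> \<omega>) \<partial>M)" for t
  proof -
    let ?X = "\<lambda>\<omega>. G \<omega> * increment_kernel (D \<omega>) t"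
    have XF: "?X \<in> borel_measurable F" using GF DF by measurable
    have XI: "integrable M ?X"
      by (rule Bochner_Integration.integrable_bound[OF iG])
         (auto simp: abs_mult abs_increment_kernel indicator_def)
    have "(\<integral>\<omega>. \<phi> \<omega> t \<partial>M) = (\<integral>\<omega>. ?X \<omega> * (indicator A (S \<omega> + real_of_int \<lfloor>t + 1/2\<rfloor>) - indicator A (S \<omega>)) \<partial>M)"
    proof (rule integral_cong_AE)
      show "AE \<omega> in M. \<phi> \<omega> t = ?X \<omega> * (indicator A (S \<omega> + real_of_int \<lfloor>t + 1/2\<rfloor>) - indicator A (S \<omega>))"
        using int by eventually_elim (simp only: \<phi>_def cell_round_int_add mult.assoc)
    qed (auto simp: \<phi>_def)
    then show ?thesis using tau[OF XF XI, of "\<lfloor>t + 1/2\<rfloor>"] by (simp add: abs_mult)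
  qed
  have "(\<integral>\<omega>. (\<integral>t. \<phi> \<omega> t \<partial>lborel) \<partial>M) = (\<integral>t. (\<integral>\<omega>. \<phi> \<omega> t \<partial>M) \<partial>lborel)"
    using PS.Fubini_integral[OF \<phi>_i] by simp
  then have "ennreal \<bar>\<integral>\<omega>. (\<integral>t. \<phi> \<omega> t \<partial>lborel) \<partial>M\<bar> \<le> (\<integral>\<^sup>+t. ennreal \<bar>\<integral>\<omega>. \<phi> \<omega> t \<partial>M\<bar> \<partial>lborel)"
    using ennreal_abs_integral_le[of lborel "\<lambda>t. \<integral>\<omega>. \<phi> \<omega> t \<partial>M"] by simp
  also have "\<dots> \<le> (\<integral>\<^sup>+t. (\<integral>\<^sup>+\<omega>. ennreal (\<bar>G \<omega>\<bar> * \<bar>increment_kernel (D \<omega>) t\<bar>) * (ennreal \<bar>real_of_int \<lfloor>t + 1/2\<rfloor>\<bar> * \<tau> \<omega>) \<partial>M) \<partial>lborel)"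
    by (intro nn_integral_mono slice)
  also have "\<dots> = (\<integral>\<^sup>+\<omega>. (\<integral>\<^sup>+t. ennreal (\<bar>G \<omega>\<bar> * \<bar>increment_kernel (D \<omega>) t\<bar>) * (ennreal \<bar>real_of_int \<lfloor>t + 1/2\<rfloor>\<bar> * \<tau> \<omega>) \<partial>lborel) \<partial>M)"
    by (rule PS.Fubini') (unfold split_beta, measurable)
  also have "\<dots> = (\<integral>\<^sup>+\<omega>. (\<integral>\<^sup>+t. (ennreal \<bar>G \<omega>\<bar> * \<tau> \<omega>) * ennreal (\<bar>increment_kernel (D \<omega>) t\<bar> * \<bar>real_of_int \<lfloor>t + 1/2\<rfloor>\<bar>) \<partial>lborel) \<partial>M)"
    by (intro nn_integral_cong) (simp add: ennreal_mult mult_ac)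
  also have "\<dots> = (\<integral>\<^sup>+\<omega>. (ennreal \<bar>G \<omega>\<bar> * \<tau> \<omega>) * (\<integral>\<^sup>+t. ennreal (\<bar>increment_kernel (D \<omega>) t\<bar> * \<bar>real_of_int \<lfloor>t + 1/2\<rfloor>\<bar>) \<partial>lborel) \<partial>M)"
    by (intro nn_integral_cong nn_integral_cmult) measurable
  also have "\<dots> \<le> (\<integral>\<^sup>+\<omega>. (ennreal \<bar>G \<omega>\<bar> * \<tau> \<omega>) * ennreal (((D \<omega>)\<^sup>2 + \<bar>D \<omega>\<bar>) / 2) \<partial>M)"
    by (intro nn_integral_mono mult_left_mono nn_integral_abs_increment_kernel_times_round) auto
  also have "\<dots> = (\<integral>\<^sup>+\<omega>. ennreal (1/2) * (ennreal (\<bar>G \<omega> * (D \<omega>)\<^sup>2\<bar> + \<bar>G \<omega> * D \<omega>\<bar>) * \<tau> \<omega>) \<partial>M)"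
  proof (intro nn_integral_cong)
    fix \<omega>
    have "ennreal \<bar>G \<omega>\<bar> * ennreal (((D \<omega>)\<^sup>2 + \<bar>D \<omega>\<bar>) / 2) = ennreal (1/2) * ennreal (\<bar>G \<omega> * (D \<omega>)\<^sup>2\<bar> + \<bar>G \<omega> * D \<omega>\<bar>)"
    proof -
      have "\<bar>G \<omega>\<bar> * (((D \<omega>)\<^sup>2 + \<bar>D \<omega>\<bar>) / 2) = 1/2 * (\<bar>G \<omega> * (D \<omega>)\<^sup>2\<bar> + \<bar>G \<omega> * D \<omega>\<bar>)"
        by (simp add: abs_mult algebra_simps)
      from arg_cong[OF this, of ennreal] show ?thesis
        by (subst (1 2) ennreal_mult[symmetric]) auto
    qed
    then show "ennreal \<bar>G \<omega>\<bar> * \<tau> \<omega> * ennreal (((D \<omega>)\<^sup>2 + \<bar>D \<omega>\<bar>) / 2) = ennreal (1/2) * (ennreal (\<bar>G \<omega> * (D \<omega>)\<^sup>2\<bar> + \<bar>G \<omega> * D \<omega>\<bar>) * \<tau> \<omega>)"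
      by (metis mult.assoc mult.commute)
  qed
  also have "\<dots> = ennreal (1/2) * (\<integral>\<^sup>+\<omega>. ennreal (\<bar>G \<omega> * (D \<omega>)\<^sup>2\<bar> + \<bar>G \<omega> * D \<omega>\<bar>) * \<tau> \<omega> \<partial>M)"
    by (rule nn_integral_cmult) measurable
  also have "\<dots> \<le> ennreal (1/2) * (\<integral>\<^sup>+\<omega>. ennreal ((\<bar>G \<omega> * (D \<omega>)\<^sup>2\<bar> + \<bar>G \<omega> * D \<omega>\<bar>) * tv_dist (K \<omega>) (K1 \<omega>)) \<partial>M)"
  proof (intro mult_left_mono nn_integral_mono_AE)
    show "AE \<omega> in M. ennreal (\<bar>G \<omega> * (D \<omega>)\<^sup>2\<bar> + \<bar>G \<omega> * D \<omega>\<bar>) * \<tau> \<omega> \<le> ennreal ((\<bar>G \<omega> * (D \<omega>)\<^sup>2\<bar> + \<bar>G \<omega> * D \<omega>\<bar>) * tv_dist (K \<omega>) (K1 \<omega>))"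
      using tau_tv
    proof eventually_elim
      fix \<omega> assume "\<tau> \<omega> \<le> ennreal (tv_dist (K \<omega>) (K1 \<omega>))"
      then show "ennreal (\<bar>G \<omega> * (D \<omega>)\<^sup>2\<bar> + \<bar>G \<omega> * D \<omega>\<bar>) * \<tau> \<omega> \<le> ennreal ((\<bar>G \<omega> * (D \<omega>)\<^sup>2\<bar> + \<bar>G \<omega> * D \<omega>\<bar>) * tv_dist (K \<omega>) (K1 \<omega>))"
        by (subst ennreal_mult') (auto intro: mult_left_mono)
    qed
  qed auto
  finally show "ennreal \<bar>\<integral>\<omega>. G \<omega> * (\<integral>t. increment_kernel (D \<omega>) t * (cell_round A (S \<omega> + t) - cell_round A (S \<omega>)) \<partial>lborel) \<partial>M\<bar>
      \<le> ennreal (1/2) * (\<integral>\<^sup>+\<omega>. ennreal ((\<bar>G \<omega> * (D \<omega>)\<^sup>2\<bar> + \<bar>G \<omega> * D \<omega>\<bar>) * tv_dist (K \<omega>) (K1 \<omega>)) \<partial>M)"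
    unfolding G_in .
qed

section \<open>The discretized normal approximation\<close>

text \<open>
  As \<open>g(S)\<close> is \<open>\<sigma>(S)\<close>-measurable, \<open>X\<close> may be replaced by \<open>E(X | S)\<close>, which has the same mean; the bound
  then follows from the Cauchy-Schwarz inequality.
\<close>

lemma variance_term_bound:
  fixes S :: "'a \<Rightarrow> real" and g :: "real \<Rightarrow> real"
  assumes M: "prob_space M" and S[measurable]: "S \<in> borel_measurable M"
    and X: "integrable M X" and g[measurable]: "g \<in> borel_measurable borel" and gC: "\<And>x. \<bar>g x\<bar> \<le> C"
  shows "ennreal \<bar>\<integral>\<omega>. ((\<integral>x. X x \<partial>M) - X \<omega>) * g (S \<omega>) \<partial>M\<bar>
     \<le> ennreal C * ennreal_sqrt (ennreal_variance M (real_cond_exp M (vimage_algebra (space M) S borel) X))"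
proof -
  interpret prob_space M by fact
  let ?F = "vimage_algebra (space M) S borel"
  have sub: "subalgebra M ?F"
    using measurable_sets[OF S] by (auto simp: subalgebra_def sets_vimage_algebra2)
  interpret finite_measure_subalgebra M ?F using sub by unfold_locales
  define E where "E = real_cond_exp M ?F X"
  define m where "m = (\<integral>x. X x \<partial>M)"
  have [measurable]: "X \<in> borel_measurable M" using X by simp
  have E: "integrable M E" "(\<integral>x. E x \<partial>M) = m" using real_cond_exp_int[OF X] by (auto simp: E_def m_def)
  have [measurable]: "E \<in> borel_measurable M" using E by simp
  have C0: "0 \<le> C" using gC[of 0] by simp
  have gS: "(\<lambda>\<omega>. g (S \<omega>)) \<in> borel_measurable ?F"
    by (rule measurable_compose[OF measurable_vimage_algebra1 g]) auto
  have bdd: "integrable M (\<lambda>\<omega>. g (S \<omega>) * Z \<omega>)" if Z: "integrable M Z" for Z :: "'a \<Rightarrow> real"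
  proof (rule Bochner_Integration.integrable_bound)
    show "integrable M (\<lambda>\<omega>. C * Z \<omega>)" using Z by simp
    show "AE \<omega> in M. norm (g (S \<omega>) * Z \<omega>) \<le> norm (C * Z \<omega>)"
      using gC C0 by (auto simp: abs_mult intro!: mult_right_mono)
  qed (use Z in auto)
  have "(\<integral>\<omega>. (m - X \<omega>) * g (S \<omega>) \<partial>M) = (\<integral>\<omega>. g (S \<omega>) * m - g (S \<omega>) * X \<omega> \<partial>M)"
    by (simp add: algebra_simps)
  also have "\<dots> = (\<integral>\<omega>. g (S \<omega>) * m \<partial>M) - (\<integral>\<omega>. g (S \<omega>) * X \<omega> \<partial>M)"
    by (rule Bochner_Integration.integral_diff[OF bdd bdd[OF X]]) simp
  also have "(\<integral>\<omega>. g (S \<omega>) * X \<omega> \<partial>M) = (\<integral>\<omega>. g (S \<omega>) * E \<omega> \<partial>M)"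
    unfolding E_def by (rule real_cond_exp_intg(2)[symmetric]) (auto intro: bdd X gS)
  also have "(\<integral>\<omega>. g (S \<omega>) * m \<partial>M) - (\<integral>\<omega>. g (S \<omega>) * E \<omega> \<partial>M) = (\<integral>\<omega>. g (S \<omega>) * (m - E \<omega>) \<partial>M)"
    unfolding right_diff_distrib by (rule Bochner_Integration.integral_diff[symmetric, OF bdd bdd[OF E(1)]]) simp
  finally have "ennreal \<bar>\<integral>\<omega>. (m - X \<omega>) * g (S \<omega>) \<partial>M\<bar> \<le> (\<integral>\<^sup>+\<omega>. ennreal \<bar>g (S \<omega>) * (m - E \<omega>)\<bar> \<partial>M)"
    using ennreal_abs_integral_le[of M "\<lambda>\<omega>. g (S \<omega>) * (m - E \<omega>)"] by simp
  also have "\<dots> \<le> (\<integral>\<^sup>+\<omega>. ennreal C * ennreal \<bar>(E \<omega> - m) * 1\<bar> \<partial>M)"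
  proof (rule nn_integral_mono)
    fix \<omega>
    have "\<bar>g (S \<omega>) * (m - E \<omega>)\<bar> \<le> C * \<bar>(E \<omega> - m) * 1\<bar>"
      using mult_right_mono[OF gC[of "S \<omega>"], of "\<bar>E \<omega> - m\<bar>"] by (simp add: abs_mult abs_minus_commute)
    then show "ennreal \<bar>g (S \<omega>) * (m - E \<omega>)\<bar> \<le> ennreal C * ennreal \<bar>(E \<omega> - m) * 1\<bar>"
      using C0 by (simp add: ennreal_mult[symmetric] ennreal_leI)
  qed
  also have "\<dots> = ennreal C * (\<integral>\<^sup>+\<omega>. ennreal \<bar>(E \<omega> - m) * 1\<bar> \<partial>M)" by (rule nn_integral_cmult) measurable
  also have "\<dots> \<le> ennreal C * (ennreal 1 * ennreal_sqrt (\<integral>\<^sup>+\<omega>. ennreal ((E \<omega> - m)\<^sup>2) \<partial>M))"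
    by (intro mult_left_mono nn_integral_mult_le_ennreal_sqrt) (auto simp: emeasure_space_1)
  finally show ?thesis by (simp add: ennreal_variance_def E E_def[symmetric] m_def[symmetric])
qed

lemma divide_ennreal_eq: "c > 0 \<Longrightarrow> x / ennreal c = ennreal (1 / c) * x"
  by (simp add: divide_ennreal_def inverse_ennreal inverse_eq_divide mult.commute)

theorem theorem1p3:
  fixes M F :: "'a measure"
    and S S' G D :: "'a \<Rightarrow> real"
    and K K1 :: "'a \<Rightarrow> real measure"
    and \<mu> \<sigma> :: real
  assumes "prob_space M"
    and "AE \<omega> in M. S \<omega> \<in> \<int>"
    and "square_integrable M S"
    and "(\<integral>\<omega>. S \<omega> \<partial>M) = \<mu>"
    and "(\<integral>\<omega>. (S \<omega> - \<mu>)\<^sup>2 \<partial>M) = \<sigma>\<^sup>2"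
    and "\<sigma> > 0"
    and "stein_coupling M S S' G"
    and "D = (\<lambda>\<omega>. S' \<omega> - S \<omega>)"
    and "subalgebra M F"
    and "subalgebra F (vimage_algebra (space M) (\<lambda>\<omega>. (G \<omega>, D \<omega>)) borel)"
    and "regular_cond_distr M F S K"
    and "regular_cond_distr M F (\<lambda>\<omega>. S \<omega> + 1) K1"
  shows "ennreal (tv_dist (distr M borel S) (discretized_normal \<mu> \<sigma>))
    \<le> ennreal (2 / \<sigma>\<^sup>2) *
        ennreal_sqrt (ennreal_variance M
          (real_cond_exp M (vimage_algebra (space M) S borel) (\<lambda>\<omega>. G \<omega> * D \<omega>)))
      + ennreal (sqrt (pi / 8)) * ((\<integral>\<^sup>+\<omega>. ennreal \<bar>G \<omega> * (D \<omega>)\<^sup>2\<bar> \<partial>M) / ennreal (\<sigma> ^ 3))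
      + ennreal_sqrt (\<integral>\<^sup>+\<omega>. ennreal ((G \<omega>)\<^sup>2 * (D \<omega>) ^ 4) \<partial>M) / ennreal (\<sigma> ^ 3)
      + ennreal (1 / (2 * \<sigma>\<^sup>2)) *
        (\<integral>\<^sup>+\<omega>. ennreal ((\<bar>G \<omega> * (D \<omega>)\<^sup>2\<bar> + \<bar>G \<omega> * D \<omega>\<bar>) * tv_dist (K \<omega>) (K1 \<omega>)) \<partial>M)"
    (is "_ \<le> ?T1 + ?T2 + ?T3 + ?T4")
proof -
  note M = assms(1) and int = assms(2) and mean = assms(4) and var = assms(5) and s = assms(6)
    and coupling = assms(7) and D = assms(8) and sub = assms(9) and K = assms(11) and K1 = assms(12)
  interpret prob_space M by fact
  have S[measurable]: "S \<in> borel_measurable M" and S2: "integrable M (\<lambda>\<omega>. (S \<omega>)\<^sup>2)"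
    and [measurable]: "S' \<in> borel_measurable M" and S'2: "integrable M (\<lambda>\<omega>. (S' \<omega>)\<^sup>2)"
    and [measurable]: "G \<in> borel_measurable M" and G2: "integrable M (\<lambda>\<omega>. (G \<omega>)\<^sup>2)"
    using coupling by (auto simp: stein_coupling_def square_integrable_def)
  have [measurable]: "D \<in> borel_measurable M" unfolding D by measurable
  have GDF: "(\<lambda>\<omega>. (G \<omega>, D \<omega>)) \<in> measurable F borel"
    by (rule measurable_from_subalg[OF assms(10)]) (rule measurable_vimage_algebra1, simp)
  have [measurable]: "(fst :: real \<times> real \<Rightarrow> real) \<in> borel_measurable borel" "(snd :: real \<times> real \<Rightarrow> real) \<in> borel_measurable borel"
    by (intro borel_measurable_continuous_onI continuous_intros)+
  then have GF: "G \<in> borel_measurable F" and DF: "D \<in> borel_measurable F"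
    using measurable_compose[OF GDF, of fst borel] measurable_compose[OF GDF, of snd borel]
    by (simp_all only: fst_conv snd_conv)
  have iG: "integrable M G" by (rule square_integrable_imp_integrable[OF _ G2]) simp
  have iS: "integrable M S" by (rule square_integrable_imp_integrable[OF _ S2]) simp
  have iGS: "integrable M (\<lambda>\<omega>. G \<omega> * S \<omega>)" "integrable M (\<lambda>\<omega>. G \<omega> * S' \<omega>)"
    using G2 S2 S'2 by (auto intro!: integrable_mult_of_squares)
  have iGD: "integrable M (\<lambda>\<omega>. G \<omega> * D \<omega>)"
    using Bochner_Integration.integrable_diff[OF iGS(2) iGS(1)] by (simp add: D right_diff_distrib)
  have iSm2: "integrable M (\<lambda>\<omega>. (S \<omega> - \<mu>)\<^sup>2)"
    using S2 iS by (simp add: power2_diff)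
  have iSmS: "integrable M (\<lambda>\<omega>. (S \<omega> - \<mu>) * S \<omega>)"
    using S2 iS by (simp add: left_diff_distrib power2_eq_square)
  have couple: "(\<integral>\<omega>. G \<omega> * f (S' \<omega>) - G \<omega> * f (S \<omega>) \<partial>M) = (\<integral>\<omega>. (S \<omega> - \<mu>) * f (S \<omega>) \<partial>M)"
    if "f \<in> borel_measurable borel" "integrable M (\<lambda>\<omega>. G \<omega> * f (S' \<omega>) - G \<omega> * f (S \<omega>))"
      "integrable M (\<lambda>\<omega>. (S \<omega> - \<mu>) * f (S \<omega>))" for f
    using coupling that unfolding stein_coupling_def mean by blast
  \<comment> \<open>The coupling identity with the identity as test function.\<close>
  have EGD: "(\<integral>\<omega>. G \<omega> * D \<omega> \<partial>M) = \<sigma>\<^sup>2"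
  proof -
    have "(\<integral>\<omega>. G \<omega> * D \<omega> \<partial>M) = (\<integral>\<omega>. (S \<omega> - \<mu>) * S \<omega> \<partial>M)"
      using couple[of "\<lambda>x. x"] iGS iSmS by (simp add: D right_diff_distrib)
    also have "\<dots> = (\<integral>\<omega>. (S \<omega> - \<mu>)\<^sup>2 + \<mu> * (S \<omega> - \<mu>) \<partial>M)"
      by (simp add: power2_eq_square algebra_simps)
    also have "\<dots> = \<sigma>\<^sup>2"
      using iSm2 iS by (simp add: var mean prob_space)
    finally show ?thesis .
  qed
  have set_bound: "ennreal \<bar>measure (distr M borel S) A - measure (discretized_normal \<mu> \<sigma>) A\<bar> \<le> ?T1 + ?T2 + ?T3 + ?T4"
    if A[measurable]: "A \<in> sets borel" for A
  proof -
    let ?h = "cell_round A"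
    define p where "p = measure (discretized_normal \<mu> \<sigma>) A"
    have h01: "0 \<le> ?h u \<and> ?h u \<le> 1" for u by (simp add: cell_round_def)
    obtain f f' where f[measurable]: "f \<in> borel_measurable borel" and f'[measurable]: "f' \<in> borel_measurable borel"
      and stein: "\<And>x. \<sigma>\<^sup>2 * f' x = (x - \<mu>) * f x + ?h x - p"
      and fb: "\<And>x. \<bar>f x\<bar> \<le> sqrt (pi / 2) / \<sigma>" and f'b: "\<And>x. \<bar>f' x\<bar> \<le> 2 / \<sigma>\<^sup>2"
      and ftc: "\<And>a b. a \<le> b \<Longrightarrow> (f' has_integral (f b - f a)) {a..b}"
      using stein_solution[OF s cell_round_measurable[OF A] h01 _ cell_round_finite_discontinuities, of p \<mu>]
        measure_discretized_normal[OF s A, of \<mu>, folded p_def] by blast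
    define J where "J \<omega> = (\<integral>t. increment_kernel (D \<omega>) t * (?h (S \<omega> + t) - ?h (S \<omega>)) \<partial>lborel)" for \<omega>
    note T4 = smoothing_term_bound[OF M sub S int A K K1 GF DF iG iGD, folded J_def]
    \<comment> \<open>\<open>V\<close> gives the variance term, \<open>R\<close> the two moment terms and \<open>G J\<close> the smoothing term.\<close>
    define V where "V \<omega> = (\<sigma>\<^sup>2 - G \<omega> * D \<omega>) * f' (S \<omega>)" for \<omega>
    define W where "W \<omega> = G \<omega> * f (S' \<omega>) - G \<omega> * f (S \<omega>)" for \<omega>
    define R where "R \<omega> = W \<omega> - G \<omega> * D \<omega> * f' (S \<omega>) - G \<omega> * J \<omega> / \<sigma>\<^sup>2" for \<omega>
    have times_bdd: "integrable M (\<lambda>\<omega>. Z \<omega> * g \<omega>)"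
      if "integrable M Z" "\<And>\<omega>. \<bar>g \<omega>\<bar> \<le> C" "g \<in> borel_measurable M" for Z g :: "'a \<Rightarrow> real" and C
    proof (rule Bochner_Integration.integrable_bound)
      show "integrable M (\<lambda>\<omega>. C * Z \<omega>)" using that by simp
      show "AE \<omega> in M. norm (Z \<omega> * g \<omega>) \<le> norm (C * Z \<omega>)"
        using order_trans[OF that(2) abs_ge_self] by (auto simp: abs_mult mult.commute[of "\<bar>C\<bar>"] intro!: mult_left_mono)
    qed (use that in auto)
    have iW: "integrable M W" unfolding W_def
      by (intro Bochner_Integration.integrable_diff times_bdd[OF iG fb]) auto
    have iSf: "integrable M (\<lambda>\<omega>. (S \<omega> - \<mu>) * f (S \<omega>))"
      using iS by (intro times_bdd[OF _ fb]) auto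
    have if': "integrable M (\<lambda>\<omega>. f' (S \<omega>))"
      using times_bdd[of "\<lambda>_. 1" "\<lambda>\<omega>. f' (S \<omega>)", OF _ f'b] by simp
    have iGDf': "integrable M (\<lambda>\<omega>. G \<omega> * D \<omega> * f' (S \<omega>))"
      by (intro times_bdd[OF iGD f'b]) auto
    have iV: "integrable M V" unfolding V_def left_diff_distrib using if' iGDf' by auto
    have iR: "integrable M R" unfolding R_def using iW iGDf' T4(2) by auto
    have EW: "(\<integral>\<omega>. W \<omega> \<partial>M) = (\<integral>\<omega>. (S \<omega> - \<mu>) * f (S \<omega>) \<partial>M)"
      unfolding W_def by (rule couple[OF f iW[unfolded W_def[abs_def]] iSf])
    have "measure (distr M borel S) A = (\<integral>\<omega>. indicator A (S \<omega>) \<partial>M)"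
    proof -
      have "measure (distr M borel S) A = (\<integral>x. indicator A x \<partial>distr M borel S)" by simp
      then show ?thesis by (subst (asm) integral_distr) auto
    qed
    also have "\<dots> = (\<integral>\<omega>. ?h (S \<omega>) \<partial>M)"
      by (rule integral_cong_AE) (use int in \<open>auto elim!: eventually_mono simp: cell_round_int_add(2)\<close>)
    also have "\<dots> = (\<integral>\<omega>. p + \<sigma>\<^sup>2 * f' (S \<omega>) - (S \<omega> - \<mu>) * f (S \<omega>) \<partial>M)"
      by (simp add: stein)
    also have "\<dots> = p + \<sigma>\<^sup>2 * (\<integral>\<omega>. f' (S \<omega>) \<partial>M) - (\<integral>\<omega>. W \<omega> \<partial>M)"
      using if' iSf by (simp add: EW prob_space)
    also have "\<sigma>\<^sup>2 * (\<integral>\<omega>. f' (S \<omega>) \<partial>M) = (\<integral>\<omega>. V \<omega> \<partial>M) + (\<integral>\<omega>. G \<omega> * D \<omega> * f' (S \<omega>) \<partial>M)"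
      using if' iGDf' by (simp add: V_def left_diff_distrib)
    also have "(\<integral>\<omega>. W \<omega> \<partial>M) = (\<integral>\<omega>. R \<omega> \<partial>M) + (\<integral>\<omega>. G \<omega> * D \<omega> * f' (S \<omega>) \<partial>M) + (\<integral>\<omega>. G \<omega> * J \<omega> \<partial>M) / \<sigma>\<^sup>2"
      unfolding R_def using iW iGDf' T4(2) by simp
    finally have "\<bar>measure (distr M borel S) A - p\<bar> \<le> \<bar>\<integral>\<omega>. V \<omega> \<partial>M\<bar> + \<bar>\<integral>\<omega>. R \<omega> \<partial>M\<bar> + \<bar>(\<integral>\<omega>. G \<omega> * J \<omega> \<partial>M) / \<sigma>\<^sup>2\<bar>"
      by linarith
    then have "ennreal \<bar>measure (distr M borel S) A - p\<bar>
        \<le> ennreal (\<bar>\<integral>\<omega>. V \<omega> \<partial>M\<bar> + \<bar>\<integral>\<omega>. R \<omega> \<partial>M\<bar> + \<bar>(\<integral>\<omega>. G \<omega> * J \<omega> \<partial>M) / \<sigma>\<^sup>2\<bar>)"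
      by (rule ennreal_leI)
    also have "\<dots> = ennreal \<bar>\<integral>\<omega>. V \<omega> \<partial>M\<bar> + ennreal \<bar>\<integral>\<omega>. R \<omega> \<partial>M\<bar> + ennreal \<bar>(\<integral>\<omega>. G \<omega> * J \<omega> \<partial>M) / \<sigma>\<^sup>2\<bar>"
      by simp
    also have "\<dots> \<le> ?T1 + (?T2 + ?T3) + ?T4"
    proof (intro add_mono)
      show "ennreal \<bar>\<integral>\<omega>. V \<omega> \<partial>M\<bar> \<le> ?T1"
        using variance_term_bound[OF M S iGD f' f'b] by (simp add: V_def EGD)
      have "ennreal \<bar>\<integral>\<omega>. R \<omega> \<partial>M\<bar> \<le> (\<integral>\<^sup>+\<omega>. ennreal \<bar>R \<omega>\<bar> \<partial>M)" by (rule ennreal_abs_integral_le)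
      also have "\<dots> \<le> (\<integral>\<^sup>+\<omega>. ennreal (1 / \<sigma> ^ 4) * ennreal \<bar>G \<omega> * (D \<omega>)\<^sup>2 * (S \<omega> - \<mu>)\<bar>
          + ennreal (sqrt (pi / 8) / \<sigma> ^ 3) * ennreal \<bar>G \<omega> * (D \<omega>)\<^sup>2\<bar> \<partial>M)"
      proof (rule nn_integral_mono)
        fix \<omega>
        have S': "S' \<omega> = S \<omega> + D \<omega>" by (simp add: D)
        have "R \<omega> = G \<omega> * (f (S \<omega> + D \<omega>) - f (S \<omega>) - D \<omega> * f' (S \<omega>) - J \<omega> / \<sigma>\<^sup>2)"
          by (simp add: R_def W_def S' algebra_simps)
        then have "\<bar>R \<omega>\<bar> \<le> \<bar>G \<omega>\<bar> * ((D \<omega>)\<^sup>2 * \<bar>S \<omega> - \<mu>\<bar> / \<sigma> ^ 4 + sqrt (pi / 8) * (D \<omega>)\<^sup>2 / \<sigma> ^ 3)"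
          unfolding J_def abs_mult
          by (auto intro!: mult_left_mono stein_solution_taylor[OF s f f' cell_round_measurable[OF A] h01 stein fb f'b ftc] simp: abs_mult)
        also have "\<dots> = 1 / \<sigma> ^ 4 * \<bar>G \<omega> * (D \<omega>)\<^sup>2 * (S \<omega> - \<mu>)\<bar> + sqrt (pi / 8) / \<sigma> ^ 3 * \<bar>G \<omega> * (D \<omega>)\<^sup>2\<bar>"
          by (simp add: abs_mult distrib_left mult_ac)
        finally have "ennreal \<bar>R \<omega>\<bar> \<le> ennreal (1 / \<sigma> ^ 4 * \<bar>G \<omega> * (D \<omega>)\<^sup>2 * (S \<omega> - \<mu>)\<bar> + sqrt (pi / 8) / \<sigma> ^ 3 * \<bar>G \<omega> * (D \<omega>)\<^sup>2\<bar>)"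
          by (rule ennreal_leI)
        also have "\<dots> = ennreal (1 / \<sigma> ^ 4) * ennreal \<bar>G \<omega> * (D \<omega>)\<^sup>2 * (S \<omega> - \<mu>)\<bar>
          + ennreal (sqrt (pi / 8) / \<sigma> ^ 3) * ennreal \<bar>G \<omega> * (D \<omega>)\<^sup>2\<bar>"
          using s by (subst (1 2) ennreal_mult[symmetric]) auto
        finally show "ennreal \<bar>R \<omega>\<bar> \<le> ennreal (1 / \<sigma> ^ 4) * ennreal \<bar>G \<omega> * (D \<omega>)\<^sup>2 * (S \<omega> - \<mu>)\<bar>
          + ennreal (sqrt (pi / 8) / \<sigma> ^ 3) * ennreal \<bar>G \<omega> * (D \<omega>)\<^sup>2\<bar>" .
      qed
      also have "\<dots> = ennreal (1 / \<sigma> ^ 4) * (\<integral>\<^sup>+\<omega>. ennreal \<bar>(G \<omega> * (D \<omega>)\<^sup>2) * (S \<omega> - \<mu>)\<bar> \<partial>M)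
          + ennreal (sqrt (pi / 8) / \<sigma> ^ 3) * (\<integral>\<^sup>+\<omega>. ennreal \<bar>G \<omega> * (D \<omega>)\<^sup>2\<bar> \<partial>M)"
        by (subst nn_integral_add) (auto simp: nn_integral_cmult)
      also have "\<dots> \<le> ?T3 + ?T2"
      proof (rule add_mono)
        have "(\<integral>\<^sup>+\<omega>. ennreal ((S \<omega> - \<mu>)\<^sup>2) \<partial>M) = ennreal (\<sigma>\<^sup>2)"
          using nn_integral_eq_integral[OF iSm2] var by simp
        then have "(\<integral>\<^sup>+\<omega>. ennreal \<bar>(G \<omega> * (D \<omega>)\<^sup>2) * (S \<omega> - \<mu>)\<bar> \<partial>M)
            \<le> ennreal \<sigma> * ennreal_sqrt (\<integral>\<^sup>+\<omega>. ennreal ((G \<omega> * (D \<omega>)\<^sup>2)\<^sup>2) \<partial>M)"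
          using s by (intro nn_integral_mult_le_ennreal_sqrt) auto
        also have "(\<lambda>\<omega>. ennreal ((G \<omega> * (D \<omega>)\<^sup>2)\<^sup>2)) = (\<lambda>\<omega>. ennreal ((G \<omega>)\<^sup>2 * (D \<omega>) ^ 4))"
          by (simp add: power_mult_distrib power_mult[symmetric])
        finally have "ennreal (1 / \<sigma> ^ 4) * (\<integral>\<^sup>+\<omega>. ennreal \<bar>(G \<omega> * (D \<omega>)\<^sup>2) * (S \<omega> - \<mu>)\<bar> \<partial>M)
            \<le> ennreal (1 / \<sigma> ^ 4) * (ennreal \<sigma> * ennreal_sqrt (\<integral>\<^sup>+\<omega>. ennreal ((G \<omega>)\<^sup>2 * (D \<omega>) ^ 4) \<partial>M))"
          by (rule mult_left_mono) simp
        also have "\<dots> = ennreal (1 / \<sigma> ^ 4 * \<sigma>) * ennreal_sqrt (\<integral>\<^sup>+\<omega>. ennreal ((G \<omega>)\<^sup>2 * (D \<omega>) ^ 4) \<partial>M)"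
          using s by (subst ennreal_mult) (auto simp: mult.assoc)
        also have "1 / \<sigma> ^ 4 * \<sigma> = 1 / \<sigma> ^ 3" using s by (simp add: power_numeral_reduce)
        finally show "ennreal (1 / \<sigma> ^ 4) * (\<integral>\<^sup>+\<omega>. ennreal \<bar>(G \<omega> * (D \<omega>)\<^sup>2) * (S \<omega> - \<mu>)\<bar> \<partial>M) \<le> ?T3"
          using s by (simp add: divide_ennreal_eq)
        have "ennreal (sqrt (pi / 8) / \<sigma> ^ 3) = ennreal (sqrt (pi / 8)) * ennreal (1 / \<sigma> ^ 3)"
          using s by (subst ennreal_mult[symmetric]) auto
        then show "ennreal (sqrt (pi / 8) / \<sigma> ^ 3) * (\<integral>\<^sup>+\<omega>. ennreal \<bar>G \<omega> * (D \<omega>)\<^sup>2\<bar> \<partial>M) \<le> ?T2"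
          using s by (simp only: divide_ennreal_eq zero_less_power mult.assoc order_refl)
      qed
      also have "?T3 + ?T2 = ?T2 + ?T3" by (rule add.commute)
      finally show "ennreal \<bar>\<integral>\<omega>. R \<omega> \<partial>M\<bar> \<le> ?T2 + ?T3" .
      have "ennreal \<bar>(\<integral>\<omega>. G \<omega> * J \<omega> \<partial>M) / \<sigma>\<^sup>2\<bar> = ennreal (1 / \<sigma>\<^sup>2) * ennreal \<bar>\<integral>\<omega>. G \<omega> * J \<omega> \<partial>M\<bar>"
        by (subst ennreal_mult[symmetric]) auto
      also have "\<dots> \<le> ennreal (1 / \<sigma>\<^sup>2) * (ennreal (1/2) * (\<integral>\<^sup>+\<omega>. ennreal ((\<bar>G \<omega> * (D \<omega>)\<^sup>2\<bar> + \<bar>G \<omega> * D \<omega>\<bar>) * tv_dist (K \<omega>) (K1 \<omega>)) \<partial>M))"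
        by (rule mult_left_mono[OF T4(1)]) simp
      also have "\<dots> = ?T4"
      proof -
        have "ennreal (1 / \<sigma>\<^sup>2) * ennreal (1/2) = ennreal (1 / (2 * \<sigma>\<^sup>2))"
          by (subst ennreal_mult[symmetric]) (auto simp: mult.commute)
        then show ?thesis by (simp only: mult.assoc[symmetric])
      qed
      finally show "ennreal \<bar>(\<integral>\<omega>. G \<omega> * J \<omega> \<partial>M) / \<sigma>\<^sup>2\<bar> \<le> ?T4" .
    qed
    finally show ?thesis by (simp only: p_def add.assoc)
  qed
  \<comment> \<open>The total variation distance is real, so an infinite bound has to be split off.\<close>
  show ?thesis
  proof (cases "?T1 + ?T2 + ?T3 + ?T4")
    case (real r)
    have "tv_dist (distr M borel S) (discretized_normal \<mu> \<sigma>) \<le> r"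
      unfolding tv_dist_def
    proof (rule cSUP_least)
      fix A :: "real set" assume "A \<in> sets borel"
      from set_bound[OF this, unfolded real(2)] real(1)
      show "\<bar>measure (distr M borel S) A - measure (discretized_normal \<mu> \<sigma>) A\<bar> \<le> r"
        by (simp only: ennreal_le_iff)
    qed auto
    then show ?thesis unfolding real(2) by (rule ennreal_leI)
  qed (simp only: top_greatest)
qed

end
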